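(* Let $p=2$, $G=SL(3)$, and let $\lambda=(\lambda_1,\lambda_2)$ be a dominant weight. Then: (1) $\mathcal{V}_{B_1}(H^0(e,\lambda))=\mathfrak{u}_\alpha\cup\mathfrak{u}_\beta$ for all $\lambda$; (2) $\mathcal{V}_{B_1}(H^0(s_\alpha,\lambda))=\mathfrak{u}_\alpha$ if $p\mid\lambda_1+1$, and $=\mathfrak{u}_\alpha\cup\mathfrak{u}_\beta$ if $p\nmid\lambda_1+1$; (3) $\mathcal{V}_{B_1}(H^0(s_\beta,\lambda))=\mathfrak{u}_\beta$ if $p\mid\lambda_2+1$, and $=\mathfrak{u}_\alpha\cup\mathfrak{u}_\beta$ if $p\nmid\lambda_2+1$; (4) $\mathcal{V}_{B_1}(H^0(s_\alpha s_\beta s_\alpha,\lambda))=\mathcal{V}_{G_1}(H^0(\lambda))\cap(\mathfrak{u}_\alpha\cup\mathfrak{u}_\beta)$ for all $\lambda$.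
   Context: Setting: $k$ is an algebraically closed field of characteristic $p=2$, $G=SL(3)$ over $k$ with maximal torus $T$, simple roots $\Delta=\{\alpha,\beta\}$, Weyl group $W$, and $B\supset T$ the Borel subgroup corresponding to the negative roots. A weight is written $\lambda=(\lambda_1,\lambda_2)$ with $\lambda_1=(\lambda,\alpha^\vee)$, $\lambda_2=(\lambda,\beta^\vee)$. $\mathfrak{u}$ is the Lie algebra of the unipotent radical of $B$. $P_\alpha\supset B$ is the minimal parabolic subgroup whose Levi factor containing $T$ has roots $\pm\alpha$, and $\mathfrak{u}_\alpha$ is the Lie algebra of its unipotent radical; similarly $P_\beta$, $\mathfrak{u}_\beta$. For $w\in W$, $X(w)$ is the closure of $B\dot wB/B$ in $G/B$; $\mathcal{L}(\lambda)$ is the line bundle on $G/B$ with $H^0(\lambda):=H^0(G/B,\mathcal{L}(\lambda))=\operatorname{ind}_B^G\lambda$; $H^0(w,\lambda)=H^0(X(w),\mathcal{L}(\lambda))$. Support varieties over the first Frobenius kernel $H_1$ of $H\in\{B,G\}$, $\mathfrak{h}=\mathrm{Lie}(H)$: for a finite-dimensional $H_1$-module $M$, $\mathcal{V}_{H_1}(M)$ is the closed subvariety of $\mathrm{Maxspec}\,H^{\bullet}(H_1,k)$ defined by the annihilator of $\mathrm{Ext}^\bullet_{H_1}(M,M)$. It is identified with $\{x\in\mathcal{N}_1(\mathfrak{h}) : M\text{ is not projective over the restricted enveloping algebra } k[x]/(x^2)\text{ of }\langle x\rangle\}\cup\{0\}$, where $\mathcal{N}_1(\mathfrak{h})=\{x\in\mathfrak{h}:x^{[2]}=0\}$;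 here $\mathcal{V}_{B_1}$ is identified with $\mathcal{N}_1(\mathfrak{u})=\mathfrak{u}_\alpha\cup\mathfrak{u}_\beta$. *)

theory Defs
  imports "HOL-Analysis.Analysis" "HOL-Algebra.Coset"
begin

section \<open>Regular functions and closed subsets of the space of \<open>3 \<times> 3\<close> matrices\<close>

type_synonym 'k mat3 = "'k^3^3"

inductive_set polyfun :: "('k::field mat3 \<Rightarrow> 'k) set" where
  const: "(\<lambda>g. c) \<in> polyfun"
| entry: "(\<lambda>g. g $ i $ j) \<in> polyfun"
| add: "F \<in> polyfun \<Longrightarrow> F' \<in> polyfun \<Longrightarrow> (\<lambda>g. F g + F' g) \<in> polyfun"
| mult: "F \<in> polyfun \<Longrightarrow> F' \<in> polyfun \<Longrightarrow> (\<lambda>g. F g * F' g) \<in> polyfun"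

definition zariski_closure :: "'k::field mat3 set \<Rightarrow> 'k mat3 set" where
  "zariski_closure S = {g. \<forall>F\<in>polyfun. (\<forall>h\<in>S. F h = 0) \<longrightarrow> F g = 0}"

definition zariski_closed :: "'k::field mat3 set \<Rightarrow> bool" where
  "zariski_closed S \<longleftrightarrow> zariski_closure S = S"

definition zariski_connected :: "'k::field mat3 set \<Rightarrow> bool" where
  "zariski_connected S \<longleftrightarrow>
     \<not> (\<exists>Z Z'. zariski_closed Z \<and> zariski_closed Z' \<and> S \<subseteq> Z \<union> Z' \<and>
              S \<inter> Z \<noteq> {} \<and> S \<inter> Z' \<noteq> {} \<and> S \<inter> Z \<inter> Z' = {})"

text \<open>
  All the varieties below are closed in \<open>SL(3)\<close>, hence in the affine space of matrices, so their
  regular functions are the restrictions of polynomial functions.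
\<close>

definition regular_on :: "'k::field mat3 set \<Rightarrow> ('k mat3 \<Rightarrow> 'k) \<Rightarrow> bool" where
  "regular_on Y f \<longleftrightarrow> (\<exists>F\<in>polyfun. \<forall>g\<in>Y. f g = F g)"


section \<open>Tangent spaces and the differential of a rational representation\<close>

text \<open>
  The formal derivative of a polynomial function \<open>F\<close> at \<open>a\<close> in direction \<open>v\<close>: the linear coefficient
  of the polynomial representing \<open>t \<mapsto> F (a + t v)\<close>. That polynomial is unique over an infinite field.
  Note that \<open>mat t\<close> is the scalar matrix \<open>t\<close>.
\<close>

definition dir_deriv :: "('k::field mat3 \<Rightarrow> 'k) \<Rightarrow> 'k mat3 \<Rightarrow> 'k mat3 \<Rightarrow> 'k" where
  "dir_deriv F a v = coeff (THE q. \<forall>t. poly q t = F (a + mat t ** v)) 1"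

text \<open>The Lie algebra of a closed subgroup is its tangent space at the identity.\<close>

definition Lie :: "'k::field mat3 set \<Rightarrow> 'k mat3 set" where
  "Lie H = {x. \<forall>F\<in>polyfun. (\<forall>h\<in>H. F h = 0) \<longrightarrow> dir_deriv F (mat 1) x = 0}"

text \<open>
  For a regular function \<open>\<phi>\<close> on \<open>H\<close> and \<open>x \<in> Lie H\<close>, the value does not depend on the polynomial
  extending \<open>\<phi>\<close>, by definition of \<open>Lie H\<close>.
\<close>

definition tangent_deriv :: "'k::field mat3 set \<Rightarrow> ('k mat3 \<Rightarrow> 'k) \<Rightarrow> 'k mat3 \<Rightarrow> 'k" where
  "tangent_deriv H \<phi> x =
     (THE c. \<exists>F\<in>polyfun. (\<forall>h\<in>H. F h = \<phi> h) \<and> c = dir_deriv F (mat 1) x)"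

definition left_translate :: "'k::field mat3 \<Rightarrow> ('k mat3 \<Rightarrow> 'k) \<Rightarrow> 'k mat3 \<Rightarrow> 'k" where
  "left_translate h f = (\<lambda>g. f (matrix_inv h ** g))"

text \<open>
  The action of \<open>x \<in> Lie H\<close> on a function \<open>f\<close>, obtained by differentiating the left translation
  action of \<open>H\<close> at the identity. This action of the restricted Lie algebra is the same thing
  as the action of the first Frobenius kernel of \<open>H\<close>.
\<close>

definition lie_act :: "'k::field mat3 set \<Rightarrow> 'k mat3 \<Rightarrow> ('k mat3 \<Rightarrow> 'k) \<Rightarrow> 'k mat3 \<Rightarrow> 'k" where
  "lie_act H x f = (\<lambda>g. tangent_deriv H (\<lambda>h. left_translate h f g) x)"


section \<open>The group \<open>SL(3)\<close> and its subgroups\<close>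

definition SL3 :: "'k::field mat3 monoid" where
  "SL3 = \<lparr>carrier = {g. det g = 1}, mult = (**), one = mat 1\<rparr>"

text \<open>
  \<open>T\<close> is the diagonal torus, \<open>\<alpha> = \<epsilon>\<^sub>1 - \<epsilon>\<^sub>2\<close> and \<open>\<beta> = \<epsilon>\<^sub>2 - \<epsilon>\<^sub>3\<close>. The positive roots
  correspond to the entries above the diagonal, so the negative Borel subgroup is lower triangular.
  The Levi factors of the two minimal parabolics are of block type (2,1) and (1,2).
\<close>

definition Borel :: "'k::field mat3 set" where
  "Borel = {g \<in> carrier SL3. g $ 1 $ 2 = 0 \<and> g $ 1 $ 3 = 0 \<and> g $ 2 $ 3 = 0}"

definition P_alpha :: "'k::field mat3 set" where
  "P_alpha = {g \<in> carrier SL3. g $ 1 $ 3 = 0 \<and> g $ 2 $ 3 = 0}"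

definition P_beta :: "'k::field mat3 set" where
  "P_beta = {g \<in> carrier SL3. g $ 1 $ 2 = 0 \<and> g $ 1 $ 3 = 0}"

definition nilpotent_mat :: "'k::field mat3 \<Rightarrow> bool" where
  "nilpotent_mat x \<longleftrightarrow> (\<exists>n. (((**) x) ^^ n) (mat 1) = 0)"

definition unipotent_mat :: "'k::field mat3 \<Rightarrow> bool" where
  "unipotent_mat g \<longleftrightarrow> nilpotent_mat (g - mat 1)"

text \<open>The largest closed connected normal unipotent subgroup of \<open>H\<close>.\<close>

definition unipotent_radical :: "'k::field mat3 set \<Rightarrow> 'k mat3 set" where
  "unipotent_radical H =
     \<Union>{N. N \<lhd> SL3\<lparr>carrier := H\<rparr> \<and> zariski_closed N \<and> zariski_connected N \<and>
          (\<forall>g\<in>N. unipotent_mat g)}"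

definition u_alpha :: "'k::field mat3 set" where
  "u_alpha = Lie (unipotent_radical P_alpha)"

definition u_beta :: "'k::field mat3 set" where
  "u_beta = Lie (unipotent_radical P_beta)"

text \<open>Representatives in \<open>SL(3)\<close>, normalizing \<open>T\<close>, of the two simple reflections.\<close>

definition s_alpha :: "'k::field mat3" where
  "s_alpha = vector [vector [0, 1, 0], vector [-1, 0, 0], vector [0, 0, 1]]"

definition s_beta :: "'k::field mat3" where
  "s_beta = vector [vector [1, 0, 0], vector [0, 0, 1], vector [0, -1, 0]]"


section \<open>Sections of line bundles on Schubert varieties\<close>

text \<open>A weight is given by its pairings with the two simple coroots.\<close>

type_synonym weight = "int \<times> int"

definition dominant :: "weight \<Rightarrow> bool" where
  "dominant lam \<longleftrightarrow> fst lam \<ge> 0 \<and> snd lam \<ge> 0"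

text \<open>
  The fundamental weights are \<open>\<epsilon>\<^sub>1\<close> and \<open>\<epsilon>\<^sub>1 + \<epsilon>\<^sub>2\<close>; the character is extended from \<open>T\<close> to the
  Borel subgroup along the projection onto the diagonal.
\<close>

definition wt_char :: "weight \<Rightarrow> 'k::field mat3 \<Rightarrow> 'k" where
  "wt_char lam b = (b $ 1 $ 1) powi (fst lam) * (b $ 1 $ 1 * b $ 2 $ 2) powi (snd lam)"

text \<open>
  The preimage in \<open>G\<close> of the Schubert variety \<open>X(w)\<close>, for a representative \<open>w\<close> of a Weyl group
  element. Closing up in the space of matrices or in \<open>SL(3)\<close> gives the same set.
\<close>

definition schubert_preimage :: "'k::field mat3 \<Rightarrow> 'k mat3 set" where
  "schubert_preimage w = zariski_closure {b ** w ** b' | b b'. b \<in> Borel \<and> b' \<in> Borel}"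

text \<open>
  For a closed right \<open>B\<close>-stable subset \<open>Y\<close> of \<open>G\<close>, the global sections over \<open>Y/B\<close> of the line bundle
  associated with \<open>lam\<close>: the regular functions \<open>f\<close> on \<open>Y\<close> with \<open>f(gb) = lam(b)\<^sup>-\<^sup>1 f(g)\<close>. Functions on \<open>Y\<close>
  are extended by zero so that each section is represented exactly once.
\<close>

definition line_sections :: "'k::field mat3 set \<Rightarrow> weight \<Rightarrow> ('k mat3 \<Rightarrow> 'k) set" where
  "line_sections Y lam = {f. regular_on Y f \<and>
     (\<forall>g\<in>Y. \<forall>b\<in>Borel. f (g ** b) = inverse (wt_char lam b) * f g) \<and> (\<forall>g. g \<notin> Y \<longrightarrow> f g = 0)}"

definition H0w :: "'k::field mat3 \<Rightarrow> weight \<Rightarrow> ('k mat3 \<Rightarrow> 'k) set" where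
  "H0w w lam = line_sections (schubert_preimage w) lam"

definition H0 :: "weight \<Rightarrow> ('k::field mat3 \<Rightarrow> 'k) set" where
  "H0 lam = line_sections (carrier SL3) lam"


section \<open>Projective modules over \<open>k[x]/(x\<^sup>2)\<close>\<close>

text \<open>
  A module over \<open>k[x]/(x\<^sup>2)\<close> is given by a space \<open>M\<close> of \<open>k\<close>-valued functions and the operator \<open>X\<close>
  on it by which \<open>x\<close> acts.
\<close>

definition kx_hom ::
  "('a \<Rightarrow> 'k::field) set \<Rightarrow> (('a \<Rightarrow> 'k) \<Rightarrow> 'a \<Rightarrow> 'k) \<Rightarrow>
   ('b \<Rightarrow> 'k) set \<Rightarrow> (('b \<Rightarrow> 'k) \<Rightarrow> 'b \<Rightarrow> 'k) \<Rightarrow> (('a \<Rightarrow> 'k) \<Rightarrow> 'b \<Rightarrow> 'k) \<Rightarrow> bool" where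
  "kx_hom M X N Y \<phi> \<longleftrightarrow>
     (\<forall>f\<in>M. \<phi> f \<in> N) \<and>
     (\<forall>f\<in>M. \<forall>g\<in>M. \<phi> (\<lambda>a. f a + g a) = (\<lambda>b. \<phi> f b + \<phi> g b)) \<and>
     (\<forall>c. \<forall>f\<in>M. \<phi> (\<lambda>a. c * f a) = (\<lambda>b. c * \<phi> f b)) \<and>
     (\<forall>f\<in>M. \<phi> (X f) = Y (\<phi> f))"

text \<open>
  The free module with one generator \<open>e\<^sub>j\<close> for each \<open>j :: 'i\<close>: here \<open>u (j, n)\<close> is the coefficient of
  \<open>x\<^sup>n e\<^sub>j\<close>.
\<close>

definition kx_free :: "('i \<times> nat \<Rightarrow> 'k::field) set" where
  "kx_free = {u. finite {a. u a \<noteq> 0} \<and> (\<forall>j n. n \<ge> 2 \<longrightarrow> u (j, n) = 0)}"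

definition kx_free_act :: "('i \<times> nat \<Rightarrow> 'k::field) \<Rightarrow> 'i \<times> nat \<Rightarrow> 'k" where
  "kx_free_act u = (\<lambda>(j, n). if n = 1 then u (j, 0) else 0)"

text \<open>
  Projective means: direct summand of a free module. Since \<open>M\<close> is generated by its own elements,
  it is enough to consider the free module on the type of these elements.
\<close>

definition kx_projective :: "('a \<Rightarrow> 'k::field) set \<Rightarrow> (('a \<Rightarrow> 'k) \<Rightarrow> 'a \<Rightarrow> 'k) \<Rightarrow> bool" where
  "kx_projective M X \<longleftrightarrow>
     (\<exists>(\<iota> :: ('a \<Rightarrow> 'k) \<Rightarrow> (('a \<Rightarrow> 'k) \<times> nat \<Rightarrow> 'k)) \<pi>.
        kx_hom M X kx_free kx_free_act \<iota> \<and> kx_hom kx_free kx_free_act M X \<pi> \<and>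
        (\<forall>f\<in>M. \<pi> (\<iota> f) = f))"


section \<open>Support varieties in characteristic 2\<close>

definition restricted_nullcone :: "'k::field mat3 set \<Rightarrow> 'k mat3 set" where
  "restricted_nullcone L = {x \<in> L. x ** x = 0}"

text \<open>
  The support variety over the first Frobenius kernel of \<open>H\<close> of a module \<open>M\<close> of functions on which \<open>H\<close>
  acts by left translation, realized inside the restricted nullcone of the Lie algebra of \<open>H\<close>.
\<close>

definition support_variety :: "'k::field mat3 set \<Rightarrow> ('k mat3 \<Rightarrow> 'k) set \<Rightarrow> 'k mat3 set" where
  "support_variety H M =
     {x \<in> restricted_nullcone (Lie H). \<not> kx_projective M (lie_act H x)} \<union> {0}"

abbreviation V_B1 :: "('k::field mat3 \<Rightarrow> 'k) set \<Rightarrow> 'k mat3 set" where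
  "V_B1 \<equiv> support_variety Borel"

abbreviation V_G1 :: "('k::field mat3 \<Rightarrow> 'k) set \<Rightarrow> 'k mat3 set" where
  "V_G1 \<equiv> support_variety (carrier SL3)"

end

theory Submission
  imports Defs "HOL-Library.Function_Algebras"
begin

text \<open>
  The restricted nullcone of the Lie algebra of \<open>B\<close> consists of the strictly lower triangular \<open>x\<close> with
  \<open>x\<^sub>2\<^sub>1 x\<^sub>3\<^sub>2 = 0\<close> (\<open>null_lower\<close>), and this is the union of \<open>u_alpha\<close> and \<open>u_beta\<close>. For such an \<open>x\<close> the line
  \<open>ray x t = 1 + t x\<close> is a one-parameter subgroup of \<open>B\<close>, all of whose elements are involutions in
  characteristic 2. So \<open>x\<close> sends a section \<open>f\<close> to the function whose value at \<open>g\<close> is the linear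
  coefficient of \<open>f ((1 + t x) g)\<close> (\<open>lie_act_eq_ray_act\<close>), whatever group the action is
  differentiated in. The preimages \<open>Y\<close> of the four Schubert varieties are the groups
  \<open>B\<close>, \<open>P_alpha\<close>, \<open>P_beta\<close> and \<open>SL(3)\<close>, so the last of the four equations expresses this
  independence of the group. For the others it remains to decide for which \<open>x\<close> the sections over \<open>Y\<close> form a projective module.
  
  Over \<open>k[x]/(x\<^sup>2)\<close> a projective module has kernel of \<open>x\<close> equal to the image of \<open>x\<close>. Every section is
  constant along \<open>1 + t x\<close>, because this line lies in the unipotent radical of \<open>B\<close>; hence every
  function \<open>x f\<close> vanishes at the identity matrix. The highest weight section \<open>\<Delta>\<^sup>a g\<^sub>3\<^sub>3\<^sup>b\<close>, with \<open>\<Delta>\<close> the lower right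
  minor of size 2 and \<open>lam = (a, b)\<close>, takes the value 1 there. So the module is not projective as soon as
  \<open>x\<close> kills this section (\<open>not_projective\<close>). That is the case for all \<open>x\<close> over \<open>B\<close>; over \<open>P_alpha\<close> it
  is the case if \<open>x\<^sub>2\<^sub>1 = 0\<close> or \<open>a\<close> is even, and over \<open>P_beta\<close> if \<open>x\<^sub>3\<^sub>2 = 0\<close> or \<open>b\<close> is even.
  
  In the remaining case over \<open>P_alpha\<close> put \<open>c = x\<^sub>2\<^sub>1 \<noteq> 0\<close> and let \<open>e\<close> be the matrix unit \<open>E\<^sub>1\<^sub>2\<close>. On
  sections \<open>x\<close> acts as \<open>c E\<^sub>2\<^sub>1\<close> does, and the commutator of \<open>e\<close> and \<open>E\<^sub>2\<^sub>1\<close> is the coroot of \<open>\<alpha>\<close>, which acts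
  through weights congruent to \<open>a\<close> modulo 2, that is, as the identity when \<open>a\<close> is odd. In characteristic 2
  this says that \<open>c\<^sup>-\<^sup>1 e\<close> is a contracting homotopy for \<open>x\<close> (\<open>projective_sl2\<close>), and a contracting
  homotopy makes the module projective (\<open>kx_projective_homotopy\<close>). The same argument works for \<open>\<beta>\<close>
  with \<open>E\<^sub>2\<^sub>3\<close>.
\<close>

section \<open>Polynomials over an algebraically closed field\<close>

lemma infinite_UNIV_alg_closed: "infinite (UNIV :: 'k::alg_closed_field set)"
proof
  assume fin: "finite (UNIV :: 'k set)"
  define p :: "'k poly" where "p = (\<Prod>a\<in>UNIV. [:-a, 1:]) + 1"
  have "degree (\<Prod>a\<in>(UNIV::'k set). [:-a, 1:]) = card (UNIV :: 'k set)"
    by (subst degree_prod_eq_sum_degree) auto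
  moreover have "card (UNIV :: 'k set) > 0"
    using fin by (simp add: card_gt_0_iff)
  ultimately have "degree p > 0"
    unfolding p_def by (subst degree_add_eq_left) auto
  then obtain x where x: "poly p x = 0"
    using alg_closed_imp_poly_has_root by blast
  have "poly (\<Prod>a\<in>UNIV. [:-a, 1:]) x = 0"
    using fin by (auto simp: poly_prod prod_zero_iff intro!: exI[of _ x])
  thus False using x by (simp add: p_def)
qed

lemma poly_eqI_cofinite:
  fixes p q :: "'k::alg_closed_field poly"
  assumes "finite A" "\<And>t. t \<notin> A \<Longrightarrow> poly p t = poly q t"
  shows "p = q"
proof (rule ccontr)
  assume "p \<noteq> q"
  hence "finite {t. poly (p - q) t = 0}"
    by (intro poly_roots_finite) simp
  moreover have "UNIV \<subseteq> A \<union> {t. poly (p - q) t = 0}"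
    using assms(2) by auto
  ultimately show False
    using assms(1) infinite_UNIV_alg_closed finite_subset by blast
qed

lemma poly_eqI_all:
  fixes p q :: "'k::alg_closed_field poly"
  assumes "\<And>t. poly p t = poly q t"
  shows "p = q"
  using poly_eqI_cofinite[of "{}"] assms by blast

text \<open>
  The operator underlying both \<open>dir_deriv\<close> and the action of a Lie algebra element; the polynomial is
  unique because the field is infinite.
\<close>

definition lin_coeff :: "('k::field \<Rightarrow> 'k) \<Rightarrow> 'k" where
  "lin_coeff \<phi> = coeff (THE q. \<forall>t. poly q t = \<phi> t) 1"

lemma lin_coeff_eq:
  fixes q :: "'k::alg_closed_field poly"
  assumes "\<And>t. poly q t = \<phi> t"
  shows "lin_coeff \<phi> = poly (pderiv q) 0"
proof -
  have "(THE q. \<forall>t. poly q t = \<phi> t) = q"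
    using assms by (intro the_equality) (auto intro: poly_eqI_all)
  thus ?thesis by (simp add: lin_coeff_def poly_0_coeff_0 coeff_pderiv)
qed

section \<open>Polynomial functions along lines of matrices\<close>

definition ray :: "'k::field mat3 \<Rightarrow> 'k \<Rightarrow> 'k mat3" where
  "ray x t = mat 1 + mat t ** x"

lemma mult_nth:
  "(x ** (y :: 'k::field mat3)) $ i $ j = x $ i $ 1 * y $ 1 $ j + x $ i $ 2 * y $ 2 $ j + x $ i $ 3 * y $ 3 $ j"
  by (simp add: matrix_matrix_mult_def sum_3)

lemma mat_mult_nth [simp]: "(mat t ** (x :: 'k::field mat3)) $ i $ j = t * x $ i $ j"
  using exhaust_3[of i] by (auto simp: mult_nth mat_def)

lemma ray_nth: "ray x t $ i $ j = (if i = j then 1 else 0) + t * x $ i $ j"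
  by (simp add: ray_def) (simp add: mat_def)

lemma ray_mult: "ray x t ** (g :: 'k::field mat3) = g + mat t ** (x ** g)"
  by (simp add: vec_eq_iff) (simp add: mult_nth ray_nth forall_3 algebra_simps)

lemma ray_mult_nth: "(ray x t ** (g :: 'k::field mat3)) $ i $ j = g $ i $ j + t * (x ** g) $ i $ j"
  by (simp add: ray_mult)

lemma ray_0 [simp]: "ray x 0 = mat 1"
  by (simp add: vec_eq_iff ray_nth mat_def)

lemma ray_add:
  assumes "x ** x = 0"
  shows "ray x t ** ray x u = ray x (t + u)"
proof -
  have "(x ** x) $ i $ j = 0" for i j using assms by simp
  hence *: "x $ i $ 1 * x $ 1 $ j + x $ i $ 2 * x $ 2 $ j + x $ i $ 3 * x $ 3 $ j = 0" for i j
    by (simp add: mult_nth)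
  have "(x ** ray x u) $ i $ j =
      x $ i $ j + u * (x $ i $ 1 * x $ 1 $ j + x $ i $ 2 * x $ 2 $ j + x $ i $ 3 * x $ 3 $ j)" for i j
    using exhaust_3[of j] by (auto simp: mult_nth ray_nth algebra_simps)
  thus ?thesis
    unfolding * by (simp add: vec_eq_iff ray_mult_nth ray_nth algebra_simps)
qed

lemma polyfun_compose:
  assumes "F \<in> polyfun" "\<And>i j. (\<lambda>h. \<Phi> h $ i $ j) \<in> polyfun"
  shows "(\<lambda>h. F (\<Phi> h)) \<in> polyfun"
  using assms by (induction F rule: polyfun.induct) (auto intro: polyfun.intros)

lemma polyfun_poly:
  assumes "F \<in> polyfun" "\<And>i j. \<exists>q. \<forall>t. poly q t = \<Phi> t $ i $ j"
  shows "\<exists>q. \<forall>t. poly q t = F (\<Phi> t)"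
  using assms
proof (induction F rule: polyfun.induct)
  case (const c)
  show ?case by (intro exI[of _ "[:c:]"]) simp
next
  case (entry i j)
  then show ?case by simp
next
  case (add F F')
  then obtain q q' where "\<forall>t. poly q t = F (\<Phi> t)" "\<forall>t. poly q' t = F' (\<Phi> t)" by blast
  thus ?case by (intro exI[of _ "q + q'"]) simp
next
  case (mult F F')
  then obtain q q' where "\<forall>t. poly q t = F (\<Phi> t)" "\<forall>t. poly q' t = F' (\<Phi> t)" by blast
  thus ?case by (intro exI[of _ "q * q'"]) simp
qed

lemma polyfun_line:
  assumes "F \<in> polyfun"
  shows "\<exists>q. \<forall>t. poly q t = F (a + mat t ** v)"
  using assms
proof (rule polyfun_poly)
  show "\<exists>q. \<forall>t. poly q t = (a + mat t ** v) $ i $ j" for i j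
    by (intro exI[of _ "[:a $ i $ j, v $ i $ j:]"]) simp
qed

text \<open>
  Density arguments are made along lines: a polynomial function that vanishes at all points but one of
  a line vanishes at that point as well.
\<close>

lemma polyfun_zero_limit:
  fixes F :: "'k::alg_closed_field mat3 \<Rightarrow> 'k"
  assumes "F \<in> polyfun" "\<And>t. t \<noteq> 0 \<Longrightarrow> F (ray x t ** g) = 0"
  shows "F g = 0"
proof -
  obtain q where q: "\<And>t. poly q t = F (ray x t ** g)"
    unfolding ray_mult using polyfun_line[OF assms(1)] by blast
  have "q = 0"
    using assms(2) by (intro poly_eqI_cofinite[of "{0}"]) (auto simp: q)
  thus ?thesis using q[of 0] by simp
qed

text \<open>
  The right invariant vector field of \<open>x\<close> maps polynomial functions to polynomial functions. It is what
  makes the action of \<open>x\<close> preserve regularity of sections.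
\<close>

lemma polyfun_derivation:
  assumes "F \<in> polyfun"
  shows "\<exists>D\<in>polyfun. \<forall>g. \<exists>q. (\<forall>t. poly q t = F (ray x t ** g)) \<and> poly (pderiv q) 0 = D g"
  using assms
proof (induction F rule: polyfun.induct)
  case (const c)
  show ?case
    by (intro bexI[of _ "\<lambda>_. 0"] polyfun.const allI exI[of _ "[:c:]"]) simp
next
  case (entry i j)
  have "(\<lambda>g. x $ i $ 1 * g $ 1 $ j + x $ i $ 2 * g $ 2 $ j + x $ i $ 3 * g $ 3 $ j) \<in> polyfun"
    by (intro polyfun.intros)
  hence D: "(\<lambda>g. (x ** g) $ i $ j) \<in> polyfun"
    by (simp add: matrix_matrix_mult_def sum_3)
  show ?case
    by (rule bexI[OF _ D], rule allI, rule_tac x = "[:g $ i $ j, (x ** g) $ i $ j:]" in exI)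
       (simp add: ray_mult_nth pderiv_pCons)
next
  case (add F F')
  then obtain D D' where D: "D \<in> polyfun" "D' \<in> polyfun"
    and *: "\<And>g. \<exists>q. (\<forall>t. poly q t = F (ray x t ** g)) \<and> poly (pderiv q) 0 = D g"
           "\<And>g. \<exists>q. (\<forall>t. poly q t = F' (ray x t ** g)) \<and> poly (pderiv q) 0 = D' g"
    by blast
  have "\<exists>q. (\<forall>t. poly q t = F (ray x t ** g) + F' (ray x t ** g)) \<and>
            poly (pderiv q) 0 = D g + D' g" for g
  proof -
    obtain q q' where "(\<forall>t. poly q t = F (ray x t ** g)) \<and> poly (pderiv q) 0 = D g"
       "(\<forall>t. poly q' t = F' (ray x t ** g)) \<and> poly (pderiv q') 0 = D' g"
      using *[of g] by blast
    thus ?thesis by (intro exI[of _ "q + q'"]) (simp add: pderiv_add)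
  qed
  thus ?case by (intro bexI[OF _ polyfun.add[OF D]] allI)
next
  case (mult F F')
  then obtain D D' where D: "D \<in> polyfun" "D' \<in> polyfun"
    and *: "\<And>g. \<exists>q. (\<forall>t. poly q t = F (ray x t ** g)) \<and> poly (pderiv q) 0 = D g"
           "\<And>g. \<exists>q. (\<forall>t. poly q t = F' (ray x t ** g)) \<and> poly (pderiv q) 0 = D' g"
    by blast
  have "\<exists>q. (\<forall>t. poly q t = F (ray x t ** g) * F' (ray x t ** g)) \<and>
            poly (pderiv q) 0 = D g * F' g + F g * D' g" for g
  proof -
    obtain q q' where q: "(\<forall>t. poly q t = F (ray x t ** g)) \<and> poly (pderiv q) 0 = D g"
       "(\<forall>t. poly q' t = F' (ray x t ** g)) \<and> poly (pderiv q') 0 = D' g"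
      using *[of g] by blast
    hence "poly q 0 = F g" "poly q' 0 = F' g" by auto
    with q show ?thesis
      by (intro exI[of _ "q * q'"]) (simp add: pderiv_mult algebra_simps)
  qed
  thus ?case
    by (intro bexI[OF _ polyfun.add[OF polyfun.mult[OF D(1) mult.hyps(2)]
          polyfun.mult[OF mult.hyps(1) D(2)]]] allI)
qed

lemma dir_deriv_lin_coeff: "dir_deriv F a v = lin_coeff (\<lambda>t. F (a + mat t ** v))"
  by (simp add: dir_deriv_def lin_coeff_def)

lemma dir_deriv_entry:
  fixes v :: "'k::alg_closed_field mat3"
  shows "dir_deriv (\<lambda>g. g $ i $ j + c) a v = v $ i $ j"
  unfolding dir_deriv_lin_coeff
  by (subst lin_coeff_eq[of "[:a $ i $ j + c, v $ i $ j:]"]) (simp_all add: pderiv_pCons)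

lemma Lie_entry:
  fixes v :: "'k::alg_closed_field mat3"
  assumes "v \<in> Lie H" "\<And>h. h \<in> H \<Longrightarrow> h $ i $ j = c"
  shows "v $ i $ j = 0"
proof -
  have "(\<lambda>g::'k mat3. g $ i $ j + (- c)) \<in> polyfun" by (intro polyfun.intros)
  hence "dir_deriv (\<lambda>g. g $ i $ j + (- c)) (mat 1) v = 0"
    using assms unfolding Lie_def by fastforce
  thus ?thesis by (simp only: dir_deriv_entry)
qed

lemma Lie_ray:
  fixes x :: "'k::alg_closed_field mat3"
  assumes "\<And>t. ray x t \<in> H"
  shows "x \<in> Lie H"
proof -
  have "lin_coeff (\<lambda>t. F (ray x t)) = 0" if "\<forall>h\<in>H. F h = 0" for F
    by (subst lin_coeff_eq[of 0]) (use that assms in auto)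
  thus ?thesis by (simp add: Lie_def dir_deriv_lin_coeff flip: ray_def)
qed

text \<open>
  The line \<open>1 + t x\<close> lies in \<open>H\<close>, so derivatives in its direction see only the values on \<open>H\<close>. This
  makes the definite description in \<open>tangent_deriv\<close> well defined, and its value does not depend on \<open>H\<close>.
\<close>

lemma tangent_deriv_ray:
  assumes "\<And>t. ray x t \<in> H" "F \<in> polyfun" "\<And>h. h \<in> H \<Longrightarrow> F h = \<phi> h"
  shows "tangent_deriv H \<phi> x = lin_coeff (\<lambda>t. \<phi> (ray x t))"
proof -
  have *: "dir_deriv F' (mat 1) x = lin_coeff (\<lambda>t. \<phi> (ray x t))" if "\<forall>h\<in>H. F' h = \<phi> h" for F'
    using that assms(1) by (simp add: dir_deriv_lin_coeff flip: ray_def)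
  show ?thesis
    unfolding tangent_deriv_def
    by (rule the_equality) (use * assms(2,3) in \<open>metis\<close>)+
qed

section \<open>Projective modules over \<open>k[x]/(x\<^sup>2)\<close>\<close>

definition scale_fun :: "'k::field \<Rightarrow> ('a \<Rightarrow> 'k) \<Rightarrow> 'a \<Rightarrow> 'k" where
  "scale_fun c f = (\<lambda>a. c * f a)"

interpretation fun_space: vector_space "scale_fun :: 'k::field \<Rightarrow> ('a \<Rightarrow> 'k) \<Rightarrow> 'a \<Rightarrow> 'k"
  by unfold_locales (auto simp: scale_fun_def fun_eq_iff algebra_simps)

lemma kx_hom_cong_left:
  "(\<And>f. f \<in> M \<Longrightarrow> X f = X' f) \<Longrightarrow> kx_hom M X N Y \<phi> \<longleftrightarrow> kx_hom M X' N Y \<phi>"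
  unfolding kx_hom_def by auto

lemma kx_hom_cong_right:
  "(\<And>f. f \<in> M \<Longrightarrow> X f = X' f) \<Longrightarrow> kx_hom N Y M X \<phi> \<longleftrightarrow> kx_hom N Y M X' \<phi>"
  unfolding kx_hom_def by auto

lemma kx_projective_cong:
  assumes "\<And>f. f \<in> M \<Longrightarrow> X f = X' f"
  shows "kx_projective M X \<longleftrightarrow> kx_projective M X'"
  unfolding kx_projective_def
  by (simp add: kx_hom_cong_left[OF assms] kx_hom_cong_right[OF assms])

text \<open>
  In a free module the kernel of \<open>x\<close> is its image, and this passes to direct summands.
\<close>

lemma kx_projective_kernel_image:
  assumes "kx_projective M X" "f \<in> M" "X f = (\<lambda>_. 0)"
  shows "\<exists>g\<in>M. X g = f"
proof -
  obtain \<iota> :: "('a \<Rightarrow> 'b) \<Rightarrow> (('a \<Rightarrow> 'b) \<times> nat \<Rightarrow> 'b)" and \<pi>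
    where \<iota>: "kx_hom M X kx_free kx_free_act \<iota>" and \<pi>: "kx_hom kx_free kx_free_act M X \<pi>"
      and \<pi>\<iota>: "\<And>f. f \<in> M \<Longrightarrow> \<pi> (\<iota> f) = f"
    using assms(1) unfolding kx_projective_def by blast
  have free: "\<iota> f \<in> kx_free" using \<iota> assms(2) by (auto simp: kx_hom_def)
  have "\<iota> (\<lambda>a. 0 * f a) = (\<lambda>b. 0 * \<iota> f b)"
    using \<iota> assms(2) unfolding kx_hom_def by blast
  hence "\<iota> (X f) = (\<lambda>b. 0)" by (simp add: assms(3))
  moreover have "\<iota> (X f) = kx_free_act (\<iota> f)"
    using \<iota> assms(2) unfolding kx_hom_def by blast
  ultimately have act0: "kx_free_act (\<iota> f) = (\<lambda>b. 0)" by simp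
  have "\<iota> f (j, 0) = 0" for j
    using fun_cong[OF act0, of "(j, 1)"] by (simp add: kx_free_act_def)
  hence z: "\<iota> f (j, n) = 0" if "n \<noteq> 1" for j n
    using that free by (cases "n = 0") (auto simp: kx_free_def)
  define u where "u = (\<lambda>(j, n::nat). if n = 0 then \<iota> f (j, 1) else 0)"
  have "{a. u a \<noteq> 0} \<subseteq> (\<lambda>(j, n). (j, 0)) ` {a. \<iota> f a \<noteq> 0}"
    by (force simp: u_def split: if_splits)
  hence u: "u \<in> kx_free"
    using free by (auto simp: kx_free_def u_def dest: finite_surj)
  have "kx_free_act u = \<iota> f"
    using z by (auto simp: kx_free_act_def u_def fun_eq_iff)
  hence "X (\<pi> u) = f" and "\<pi> u \<in> M"
    using \<pi> u \<pi>\<iota>[OF assms(2)] unfolding kx_hom_def by metis+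
  thus ?thesis by blast
qed

text \<open>
  A contracting homotopy \<open>s\<close> splits the action map \<open>m\<^sub>0 + x m\<^sub>1 \<mapsto> m\<^sub>0 + X m\<^sub>1\<close> from the free module on a
  basis of \<open>M\<close>: the splitting sends \<open>f\<close> to \<open>s (X f) + x (s f)\<close>. It commutes with \<open>x\<close> because \<open>X\<close> squares to
  zero, and it is a section of the action map by the homotopy identity.
\<close>

lemma kx_projective_homotopy:
  fixes M :: "('a \<Rightarrow> 'k::field) set"
  assumes M: "fun_space.subspace M"
    and X: "\<And>f. f \<in> M \<Longrightarrow> X f \<in> M"
      "\<And>f g. f \<in> M \<Longrightarrow> g \<in> M \<Longrightarrow> X (f + g) = X f + X g"
      "\<And>c f. f \<in> M \<Longrightarrow> X (scale_fun c f) = scale_fun c (X f)"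
      "\<And>f. f \<in> M \<Longrightarrow> X (X f) = 0"
    and s: "\<And>f. f \<in> M \<Longrightarrow> s f \<in> M"
      "\<And>f g. f \<in> M \<Longrightarrow> g \<in> M \<Longrightarrow> s (f + g) = s f + s g"
      "\<And>c f. f \<in> M \<Longrightarrow> s (scale_fun c f) = scale_fun c (s f)"
    and hom: "\<And>f. f \<in> M \<Longrightarrow> s (X f) + X (s f) = f"
  shows "kx_projective M X"
proof -
  obtain B where B: "B \<subseteq> M" "fun_space.independent B" "M \<subseteq> fun_space.span B"
    using fun_space.basis_exists by metis
  have span: "fun_space.span B = M"
    using B M fun_space.span_subspace by blast
  define rep where "rep = fun_space.representation B"
  define comb where "comb = (\<lambda>c. \<Sum>b | b \<in> B \<and> c b \<noteq> 0. scale_fun (c b) b)"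
  have comb_M: "comb c \<in> M" for c
    unfolding comb_def using B(1) M
    by (intro fun_space.subspace_sum fun_space.subspace_scale) auto
  have comb_superset: "comb c = (\<Sum>b\<in>S. scale_fun (c b) b)"
    if "finite S" "S \<subseteq> B" "{b \<in> B. c b \<noteq> 0} \<subseteq> S" for c S
    unfolding comb_def using that by (intro sum.mono_neutral_left) (auto simp: scale_fun_def fun_eq_iff)
  have comb_add: "comb (\<lambda>b. c b + d b) = comb c + comb d"
    if "finite {b. c b \<noteq> 0}" "finite {b. d b \<noteq> 0}" for c d
  proof -
    let ?S = "{b \<in> B. c b \<noteq> 0} \<union> {b \<in> B. d b \<noteq> 0}"
    have fin: "finite ?S" using that by auto
    have "comb (\<lambda>b. c b + d b) = (\<Sum>b\<in>?S. scale_fun (c b + d b) b)"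
      by (rule comb_superset[OF fin]) auto
    moreover have "comb c = (\<Sum>b\<in>?S. scale_fun (c b) b)"
      by (rule comb_superset[OF fin]) auto
    moreover have "comb d = (\<Sum>b\<in>?S. scale_fun (d b) b)"
      by (rule comb_superset[OF fin]) auto
    ultimately show ?thesis by (simp add: fun_space.scale_left_distrib sum.distrib)
  qed
  have comb_scale: "comb (\<lambda>b. e * c b) = scale_fun e (comb c)" if "finite {b. c b \<noteq> 0}" for c e
  proof -
    let ?S = "{b \<in> B. c b \<noteq> 0}"
    have fin: "finite ?S" using that by auto
    have "comb (\<lambda>b. e * c b) = (\<Sum>b\<in>?S. scale_fun (e * c b) b)"
      by (rule comb_superset[OF fin]) auto
    thus ?thesis by (simp add: comb_def fun_space.scale_sum_right)
  qed
  have comb_rep: "comb (rep f) = f" if "f \<in> M" for f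
  proof -
    have "{b \<in> B. rep f b \<noteq> 0} = {b. rep f b \<noteq> 0}"
      unfolding rep_def using fun_space.representation_ne_zero by auto
    thus ?thesis
      unfolding comb_def rep_def
      using fun_space.sum_nonzero_representation_eq[OF B(2)] that span by simp
  qed
  have fin_rep: "finite {b. rep f b \<noteq> 0}" for f
    unfolding rep_def by (rule fun_space.finite_representation)
  have rep_add: "rep (f + g) b = rep f b + rep g b" if "f \<in> M" "g \<in> M" for f g b
    unfolding rep_def using that span B(2) by (simp add: fun_space.representation_add)
  have rep_scale: "rep (scale_fun c f) b = c * rep f b" if "f \<in> M" for c f b
    unfolding rep_def using that span B(2) by (simp add: fun_space.representation_scale)
  have rep_0: "rep 0 b = 0" for b
    unfolding rep_def by (simp add: fun_space.representation_zero)
  define \<iota> where "\<iota> = (\<lambda>f (j, n::nat).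
    if n = 0 then rep (s (X f)) j else if n = 1 then rep (s f) j else 0)"
  define \<pi> where "\<pi> = (\<lambda>u. comb (\<lambda>j. u (j, 0::nat)) + X (comb (\<lambda>j. u (j, 1))))"
  have s0: "s 0 = 0"
  proof -
    have "s (scale_fun 0 0) = scale_fun 0 (s 0)"
      using M fun_space.subspace_0 by (intro s(3)) blast
    thus ?thesis by simp
  qed
  have "kx_hom M X kx_free kx_free_act \<iota>"
    unfolding kx_hom_def
  proof (intro conjI ballI allI)
    fix f assume f: "f \<in> M"
    have "{a. \<iota> f a \<noteq> 0} \<subseteq> {b. rep (s (X f)) b \<noteq> 0} \<times> {0} \<union> {b. rep (s f) b \<noteq> 0} \<times> {1}"
      by (auto simp: \<iota>_def split: if_splits)
    moreover have "finite \<dots>" using fin_rep by auto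
    ultimately show "\<iota> f \<in> kx_free"
      using finite_subset by (auto simp: kx_free_def \<iota>_def)
    show "\<iota> (X f) = kx_free_act (\<iota> f)"
      by (intro ext) (simp add: \<iota>_def kx_free_act_def X(4)[OF f] s0 rep_0 split: prod.splits)
    have "\<iota> (scale_fun c f) = (\<lambda>b. c * \<iota> f b)" for c
      by (intro ext)
         (simp add: \<iota>_def X(3)[OF f] s(3)[OF f] s(3)[OF X(1)[OF f]] rep_scale[OF s(1)[OF f]]
           rep_scale[OF s(1)[OF X(1)[OF f]]] split: prod.splits)
    thus "\<iota> (\<lambda>a. c * f a) = (\<lambda>b. c * \<iota> f b)" for c
      by (simp only: scale_fun_def)
    fix g assume g: "g \<in> M"
    have "\<iota> (f + g) = (\<lambda>b. \<iota> f b + \<iota> g b)"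
      by (intro ext)
         (simp add: \<iota>_def X(2)[OF f g] s(2)[OF f g] s(2)[OF X(1)[OF f] X(1)[OF g]]
           rep_add[OF s(1)[OF f] s(1)[OF g]] rep_add[OF s(1)[OF X(1)[OF f]] s(1)[OF X(1)[OF g]]]
           split: prod.splits)
    thus "\<iota> (\<lambda>a. f a + g a) = (\<lambda>b. \<iota> f b + \<iota> g b)"
      by (simp only: plus_fun_def)
  qed
  moreover have "kx_hom kx_free kx_free_act M X \<pi>"
    unfolding kx_hom_def
  proof (intro conjI ballI allI)
    have fin: "finite {j. u (j, n) \<noteq> 0}" if "u \<in> kx_free"
      for u :: "('a \<Rightarrow> 'k) \<times> nat \<Rightarrow> 'k" and n
    proof -
      have "{j. u (j, n) \<noteq> 0} \<subseteq> fst ` {a. u a \<noteq> 0}" by force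
      thus ?thesis using that finite_subset by (auto simp: kx_free_def)
    qed
    fix u :: "('a \<Rightarrow> 'k) \<times> nat \<Rightarrow> 'k" assume u: "u \<in> kx_free"
    show "\<pi> u \<in> M"
      unfolding \<pi>_def using comb_M X(1) M by (intro fun_space.subspace_add) auto
    have comb0: "comb (\<lambda>j. 0) = 0" by (simp add: comb_def)
    show "\<pi> (kx_free_act u) = X (\<pi> u)"
      using X(2)[OF comb_M X(1)[OF comb_M]] X(4)[OF comb_M]
      by (simp add: \<pi>_def kx_free_act_def comb0)
    have "\<pi> (\<lambda>a. c * u a) = scale_fun c (\<pi> u)" for c
      using X(3)[OF comb_M] comb_scale[OF fin[OF u]]
      by (simp add: \<pi>_def fun_space.scale_right_distrib)
    thus "\<pi> (\<lambda>a. c * u a) = (\<lambda>b. c * \<pi> u b)" for c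
      by (simp add: scale_fun_def)
    fix v :: "('a \<Rightarrow> 'k) \<times> nat \<Rightarrow> 'k" assume v: "v \<in> kx_free"
    have "\<pi> (\<lambda>a. u a + v a) = \<pi> u + \<pi> v"
      by (simp add: \<pi>_def comb_add[OF fin[OF u] fin[OF v]] X(2)[OF comb_M comb_M] add_ac)
    thus "\<pi> (\<lambda>a. u a + v a) = (\<lambda>b. \<pi> u b + \<pi> v b)"
      by (simp only: plus_fun_def)
  qed
  moreover have "\<pi> (\<iota> f) = f" if "f \<in> M" for f
    using hom[OF that] X(1) s(1) that by (simp add: \<pi>_def \<iota>_def comb_rep)
  ultimately show ?thesis unfolding kx_projective_def by blast
qed

section \<open>The group \<open>SL(3)\<close>\<close>

text \<open>
  The adjugate matrix. It expresses inverses in \<open>SL(3)\<close> by polynomial functions.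
\<close>

definition adj3 :: "'k::field mat3 \<Rightarrow> 'k mat3" where
  "adj3 x = vector [
     vector [x$2$2 * x$3$3 - x$2$3 * x$3$2, x$1$3 * x$3$2 - x$1$2 * x$3$3, x$1$2 * x$2$3 - x$1$3 * x$2$2],
     vector [x$2$3 * x$3$1 - x$2$1 * x$3$3, x$1$1 * x$3$3 - x$1$3 * x$3$1, x$1$3 * x$2$1 - x$1$1 * x$2$3],
     vector [x$2$1 * x$3$2 - x$2$2 * x$3$1, x$1$2 * x$3$1 - x$1$1 * x$3$2, x$1$1 * x$2$2 - x$1$2 * x$2$1]]"

lemma mat_1_nth: "(mat 1 :: 'k::field mat3) $ i $ j = (if i = j then 1 else 0)"
  by (simp add: mat_def)

lemma adj3_nth:
  "adj3 x $1$1 = x$2$2 * x$3$3 - x$2$3 * x$3$2"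
  "adj3 x $1$2 = x$1$3 * x$3$2 - x$1$2 * x$3$3"
  "adj3 x $1$3 = x$1$2 * x$2$3 - x$1$3 * x$2$2"
  "adj3 x $2$1 = x$2$3 * x$3$1 - x$2$1 * x$3$3"
  "adj3 x $2$2 = x$1$1 * x$3$3 - x$1$3 * x$3$1"
  "adj3 x $2$3 = x$1$3 * x$2$1 - x$1$1 * x$2$3"
  "adj3 x $3$1 = x$2$1 * x$3$2 - x$2$2 * x$3$1"
  "adj3 x $3$2 = x$1$2 * x$3$1 - x$1$1 * x$3$2"
  "adj3 x $3$3 = x$1$1 * x$2$2 - x$1$2 * x$2$1"
  by (simp_all add: adj3_def)

lemma adj3_mult:
  assumes "det x = 1"
  shows "adj3 x ** x = mat 1" "x ** adj3 x = mat 1"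
proof -
  have *: "x$1$1*x$2$2*x$3$3 + x$1$2*x$2$3*x$3$1 + x$1$3*x$2$1*x$3$2
     - x$1$1*x$2$3*x$3$2 - x$1$2*x$2$1*x$3$3 - x$1$3*x$2$2*x$3$1 = 1"
    using assms by (simp add: det_3)
  show "adj3 x ** x = mat 1"
    unfolding vec_eq_iff forall_3
    by (intro conjI; simp add: mult_nth adj3_def mat_def) (use * in \<open>simp add: algebra_simps\<close>)+
  show "x ** adj3 x = mat 1"
    unfolding vec_eq_iff forall_3
    by (intro conjI; simp add: mult_nth adj3_def mat_def) (use * in \<open>simp add: algebra_simps\<close>)+
qed

lemma det_adj3: "det x = 1 \<Longrightarrow> det (adj3 x) = 1"
  by (metis adj3_mult(1) det_I det_mul mult.right_neutral)

lemma matrix_inv_adj3: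
  fixes x :: "'k::field mat3"
  assumes "det x = 1"
  shows "matrix_inv x = adj3 x"
proof -
  have "x ** matrix_inv x = mat 1"
    using adj3_mult[OF assms] unfolding matrix_inv_def
    by (metis (mono_tags, lifting) someI_ex)
  thus ?thesis
    by (metis adj3_mult(1) assms matrix_mul_assoc matrix_mul_lid matrix_mul_rid)
qed

lemma adj3_unique: "det x = 1 \<Longrightarrow> x ** y = mat 1 \<Longrightarrow> adj3 x = y"
  by (metis adj3_mult(1) matrix_mul_assoc matrix_mul_lid matrix_mul_rid)

lemma polyfun_diff:
  assumes "F \<in> polyfun" "F' \<in> polyfun"
  shows "(\<lambda>g. F g - F' g) \<in> polyfun"
  using polyfun.add[OF assms(1) polyfun.mult[OF polyfun.const[of "-1"] assms(2)]] by simp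

lemma polyfun_power: "F \<in> polyfun \<Longrightarrow> (\<lambda>g. F g ^ n) \<in> polyfun"
  by (induction n) (auto intro: polyfun.intros)

lemmas polyfun_intros = polyfun.intros polyfun_diff polyfun_power

lemma polyfun_adj3: "(\<lambda>x :: 'k::field mat3. adj3 x $ i $ j) \<in> polyfun"
proof -
  have "\<forall>i j. (\<lambda>x. adj3 x $ i $ j) \<in> polyfun"
    by (simp add: forall_3 adj3_def; intro conjI polyfun_intros)
  thus ?thesis by blast
qed

lemma polyfun_det: "(\<lambda>x::'k::field mat3. det x) \<in> polyfun"
  unfolding det_3 by (intro polyfun_intros)

lemma polyfun_mult_right:
  "F \<in> polyfun \<Longrightarrow> (\<lambda>h. F (h ** (g :: 'k::field mat3))) \<in> polyfun"
  by (erule polyfun_compose) (simp add: mult_nth, intro polyfun_intros)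

lemma polyfun_translate:
  "F \<in> polyfun \<Longrightarrow> (\<lambda>h. F (adj3 h ** g)) \<in> polyfun"
  using polyfun_compose[OF polyfun_mult_right polyfun_adj3] .

definition unit_mat :: "3 \<Rightarrow> 3 \<Rightarrow> 'k::field mat3" where
  "unit_mat i j = (\<chi> a b. if a = i \<and> b = j then 1 else 0)"

lemma unit_mat_nth [simp]: "unit_mat i j $ a $ b = (if a = i \<and> b = j then 1 else 0)"
  by (simp add: unit_mat_def)

lemma carrier_SL3 [simp]: "g \<in> carrier SL3 \<longleftrightarrow> det g = 1"
  by (simp add: SL3_def)

lemma mult_SL3 [simp]: "g \<otimes>\<^bsub>SL3\<^esub> h = g ** h"
  by (simp add: SL3_def)

lemma one_SL3 [simp]: "\<one>\<^bsub>SL3\<^esub> = mat 1"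
  by (simp add: SL3_def)

lemma group_SL3: "group (SL3 :: 'k::field mat3 monoid)"
proof (rule groupI)
  fix g :: "'k mat3" assume "g \<in> carrier SL3"
  thus "\<exists>h\<in>carrier SL3. h \<otimes>\<^bsub>SL3\<^esub> g = \<one>\<^bsub>SL3\<^esub>"
    by (intro bexI[of _ "adj3 g"]) (simp_all add: adj3_mult det_adj3)
qed (simp_all add: det_mul matrix_mul_assoc)

lemma inv_SL3: "det g = 1 \<Longrightarrow> inv\<^bsub>SL3\<^esub> g = adj3 g"
  by (intro group.inv_equality[OF group_SL3]) (simp_all add: adj3_mult det_adj3)

lemma subgroup_SL3I:
  assumes "H \<subseteq> carrier SL3" "mat 1 \<in> H" "\<And>g h. g \<in> H \<Longrightarrow> h \<in> H \<Longrightarrow> g ** h \<in> H"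
    "\<And>g. g \<in> H \<Longrightarrow> adj3 g \<in> H"
  shows "subgroup H SL3"
  using assms by (intro group.subgroupI[OF group_SL3]) (auto simp: inv_SL3)

lemma Borel_iff: "g \<in> Borel \<longleftrightarrow> g$1$1 * g$2$2 * g$3$3 = 1 \<and> g$1$2 = 0 \<and> g$1$3 = 0 \<and> g$2$3 = 0"
  by (auto simp: Borel_def det_3)

lemma subgroup_Borel: "subgroup (Borel :: 'k::field mat3 set) SL3"
  by (rule subgroup_SL3I) (auto simp: Borel_def det_mul det_adj3 mult_nth adj3_nth mat_1_nth)

lemma subgroup_P_alpha: "subgroup (P_alpha :: 'k::field mat3 set) SL3"
  by (rule subgroup_SL3I) (auto simp: P_alpha_def det_mul det_adj3 mult_nth adj3_nth mat_1_nth)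

lemma subgroup_P_beta: "subgroup (P_beta :: 'k::field mat3 set) SL3"
  by (rule subgroup_SL3I) (auto simp: P_beta_def det_mul det_adj3 mult_nth adj3_nth mat_1_nth)

lemma Borel_subset_P: "Borel \<subseteq> P_alpha" "Borel \<subseteq> P_beta"
  by (auto simp: Borel_def P_alpha_def P_beta_def)

lemma Borel_subset_SL3: "Borel \<subseteq> carrier SL3"
  by (auto simp: Borel_def)

section \<open>The restricted nullcone of the Borel subalgebra\<close>

definition null_lower :: "'k::field mat3 set" where
  "null_lower = {x. x$1$1 = 0 \<and> x$1$2 = 0 \<and> x$1$3 = 0 \<and> x$2$2 = 0 \<and> x$2$3 = 0 \<and> x$3$3 = 0 \<and>
                    x$2$1 * x$3$2 = 0}"

lemma null_lower_square: "x \<in> null_lower \<Longrightarrow> x ** x = 0"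
  by (auto simp: null_lower_def vec_eq_iff forall_3 mult_nth)

lemma null_lower_ray: "x \<in> null_lower \<Longrightarrow> ray x t \<in> Borel"
  by (auto simp: null_lower_def Borel_iff ray_nth)

lemma restricted_nullcone_Borel:
  "restricted_nullcone (Lie (Borel :: 'k::alg_closed_field mat3 set)) = null_lower"
proof (intro equalityI subsetI)
  fix x :: "'k mat3" assume x: "x \<in> restricted_nullcone (Lie Borel)"
  hence L: "x \<in> Lie Borel" and sq: "x ** x = 0" by (auto simp: restricted_nullcone_def)
  have "x$1$2 = 0" "x$1$3 = 0" "x$2$3 = 0"
    by (rule Lie_entry[OF L], force simp: Borel_def)+
  moreover have entries: "(x ** x) $ i $ j = 0" for i j using sq by simp
  ultimately show "x \<in> null_lower"
    using entries[of 1 1] entries[of 2 2] entries[of 3 3] entries[of 3 1]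
    by (auto simp: null_lower_def mult_nth)
next
  fix x :: "'k mat3" assume "x \<in> null_lower"
  thus "x \<in> restricted_nullcone (Lie Borel)"
    using Lie_ray null_lower_ray null_lower_square unfolding restricted_nullcone_def by blast
qed

section \<open>Unipotent radicals of the minimal parabolics\<close>

lemma zariski_closedI:
  assumes "\<And>g. g \<notin> S \<Longrightarrow> \<exists>F\<in>polyfun. (\<forall>h\<in>S. F h = 0) \<and> F g \<noteq> 0"
  shows "zariski_closed S"
  using assms unfolding zariski_closed_def zariski_closure_def by blast

lemma zariski_closed_equations:
  assumes "\<F> \<subseteq> polyfun"
  shows "zariski_closed {g. \<forall>F\<in>\<F>. F g = 0}"
  using assms by (intro zariski_closedI) blast

text \<open>
  If two disjoint closed pieces covered \<open>S\<close>, then on the line joining a point of one to a point of the other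
  the product of two nonzero polynomials would vanish.
\<close>

lemma zariski_connected_affine:
  fixes S :: "'k::alg_closed_field mat3 set"
  assumes "\<And>g h t. g \<in> S \<Longrightarrow> h \<in> S \<Longrightarrow> g + mat t ** (h - g) \<in> S"
  shows "zariski_connected S"
  unfolding zariski_connected_def
proof (intro notI, elim exE conjE)
  fix Z Z' assume Z: "zariski_closed Z" "zariski_closed Z'" "S \<subseteq> Z \<union> Z'"
    "S \<inter> Z \<noteq> {}" "S \<inter> Z' \<noteq> {}" "S \<inter> Z \<inter> Z' = {}"
  then obtain g h where gh: "g \<in> S" "g \<in> Z" "h \<in> S" "h \<in> Z'" "g \<notin> Z'" "h \<notin> Z" by blast
  have "h \<notin> zariski_closure Z" "g \<notin> zariski_closure Z'"
    using Z(1,2) gh(5,6) by (auto simp: zariski_closed_def)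
  then obtain F F' where F: "F \<in> polyfun" "\<And>x. x \<in> Z \<Longrightarrow> F x = 0" "F h \<noteq> 0"
    and F': "F' \<in> polyfun" "\<And>x. x \<in> Z' \<Longrightarrow> F' x = 0" "F' g \<noteq> 0"
    unfolding zariski_closure_def by blast
  let ?l = "\<lambda>t. g + mat t ** (h - g)"
  obtain q q' where q: "\<And>t. poly q t = F (?l t)" and q': "\<And>t. poly q' t = F' (?l t)"
    using polyfun_line[OF F(1)] polyfun_line[OF F'(1)] by blast
  have "q * q' = 0"
    using assms[OF gh(1,3)] Z(3) F(2) F'(2) by (intro poly_eqI_all) (auto simp: q q')
  moreover have "poly q 1 \<noteq> 0" using F(3) by (simp add: q)
  moreover have "?l 0 = g" by (simp add: vec_eq_iff)
  hence "poly q' 0 \<noteq> 0" using F'(3) by (simp add: q')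
  ultimately show False by auto
qed

text \<open>
  The diagonal block of a nilpotent block triangular matrix is nilpotent, hence has trace and determinant
  zero. The predicate \<open>Q\<close> stands for the block triangular shape, which the powers of \<open>x\<close> inherit.
\<close>

lemma nilpotent_block:
  fixes x :: "'k::field mat3"
  assumes nil: "nilpotent_mat x"
    and Q: "Q (mat 1)" "\<And>y. Q y \<Longrightarrow> Q (x ** y)"
    and "i \<noteq> j"
    and mult: "\<And>y a b. Q y \<Longrightarrow> a \<in> {i, j} \<Longrightarrow> b \<in> {i, j} \<Longrightarrow>
                  (x ** y) $ a $ b = x $ a $ i * y $ i $ b + x $ a $ j * y $ j $ b"
  shows "x $ i $ i + x $ j $ j = 0" "x $ i $ i * x $ j $ j = x $ i $ j * x $ j $ i"
proof -
  define y where "y n = ((**) x ^^ n) (mat 1)" for n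
  define \<delta> where "\<delta> z = z $ i $ i * z $ j $ j - z $ i $ j * z $ j $ i" for z :: "'k mat3"
  define \<tau> where "\<tau> = x $ i $ i + x $ j $ j"
  have y_Suc: "y (Suc n) = x ** y n" for n by (simp add: y_def)
  have Qy: "Q (y n)" for n by (induction n) (auto simp: y_def Q)
  obtain N where N: "y N = 0" using nil by (auto simp: nilpotent_mat_def y_def)
  have "\<delta> (y n) = \<delta> x ^ n" for n
  proof (induction n)
    case 0
    show ?case using \<open>i \<noteq> j\<close> by (simp add: y_def \<delta>_def mat_def)
  next
    case (Suc n)
    have "\<delta> (y (Suc n)) = \<delta> x * \<delta> (y n)"
      by (simp add: \<delta>_def y_Suc mult[OF Qy] algebra_simps)
    thus ?case using Suc by simp
  qed
  from this[of N] have \<delta>: "\<delta> x = 0" by (simp add: N \<delta>_def[of 0])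
  thus "x $ i $ i * x $ j $ j = x $ i $ j * x $ j $ i" by (simp add: \<delta>_def)
  \<comment> \<open>Cayley-Hamilton for the block, whose determinant is already known to vanish\<close>
  have square: "x $ a $ i * x $ i $ b + x $ a $ j * x $ j $ b = \<tau> * x $ a $ b"
    if "a \<in> {i, j}" "b \<in> {i, j}" for a b
    using that \<delta> by (auto simp: \<delta>_def \<tau>_def algebra_simps)
  have powers: "y (Suc n) $ a $ b = \<tau> ^ n * x $ a $ b" if "a \<in> {i, j}" "b \<in> {i, j}" for n a b
    using that
  proof (induction n arbitrary: a b)
    case 0
    thus ?case by (simp add: y_def)
  next
    case (Suc n)
    have "y (Suc (Suc n)) $ a $ b = \<tau> ^ n * (x $ a $ i * x $ i $ b + x $ a $ j * x $ j $ b)"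
      using Suc by (simp add: y_Suc[of "Suc n"] mult[OF Qy] algebra_simps)
    thus ?case using square Suc.prems by simp
  qed
  have "\<tau> ^ N * x $ i $ i = 0" "\<tau> ^ N * x $ j $ j = 0"
    using powers[of i i N] powers[of j j N] by (simp_all add: y_Suc N)
  hence "\<tau> ^ N * \<tau> = 0" by (simp only: \<tau>_def distrib_left add_0)
  thus "x $ i $ i + x $ j $ j = 0" by (auto simp: \<tau>_def)
qed

text \<open>
  A normal subgroup of the Levi factor that consists of unipotent elements is trivial. Let the entries \<open>a b c d\<close> be
  those of a \<open>2 \<times> 2\<close> block \<open>A\<close> of an element of such a subgroup. Unipotent blocks have trace \<open>2 = 0\<close>, and this applies to \<open>A\<close>
  and to the products of \<open>A\<close> with its conjugates. The last two hypotheses are the traces of the products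
  with the conjugates by the reflection \<open>(0 1; -1 0)\<close> and by \<open>(1 0; 1 1)\<close>; the latter forces
  \<open>b = 0\<close>, and the former then forces \<open>c = 0\<close>.
\<close>

lemma block_trivial:
  fixes a b c d :: "'k::field"
  assumes two: "(2::'k) = 0"
    and "a + d = 0" "(a - 1) * (d - 1) = b * c"
    and "2 * a * d - b * b - c * c = 0" "a * a + d * d + 2 * b * c - b * b = 0"
  shows "a = 1 \<and> d = 1 \<and> b = 0 \<and> c = 0"
proof -
  have neg: "- z = z" for z :: 'k
    using two by (metis add.inverse_unique mult_2 mult_zero_left)
  have d: "d = a" using assms(2) neg[of a] by (metis add_eq_0_iff)
  have "b * b = 2 * a * a + 2 * b * c" using assms(5) d by (simp add: algebra_simps)
  hence b: "b = 0" by (simp add: two)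
  have "c = 0" using assms(4) b two by simp
  thus ?thesis using assms(3) b d by simp
qed

definition U_alpha :: "'k::field mat3 set" where
  "U_alpha = {g. g$1$1 = 1 \<and> g$2$2 = 1 \<and> g$3$3 = 1 \<and> g$1$2 = 0 \<and> g$1$3 = 0 \<and> g$2$1 = 0 \<and> g$2$3 = 0}"

definition U_beta :: "'k::field mat3 set" where
  "U_beta = {g. g$1$1 = 1 \<and> g$2$2 = 1 \<and> g$3$3 = 1 \<and> g$1$2 = 0 \<and> g$1$3 = 0 \<and> g$2$3 = 0 \<and> g$3$2 = 0}"

lemma U_alpha_P: "U_alpha \<subseteq> P_alpha"
  by (auto simp: U_alpha_def P_alpha_def det_3)

lemma U_beta_P: "U_beta \<subseteq> P_beta"
  by (auto simp: U_beta_def P_beta_def det_3)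

lemma subgroup_SL3_normalI:
  assumes P: "subgroup P SL3" and N: "subgroup N SL3" "N \<subseteq> P"
    and "\<And>x h. x \<in> P \<Longrightarrow> h \<in> N \<Longrightarrow> x ** h ** adj3 x \<in> N"
  shows "N \<lhd> SL3\<lparr>carrier := P\<rparr>"
proof -
  interpret PG: group "SL3\<lparr>carrier := P\<rparr>"
    using group.subgroup_imp_group[OF group_SL3 P] .
  have "subgroup N (SL3\<lparr>carrier := P\<rparr>)"
    using group.subgroup_incl[OF group_SL3 N(1) P N(2)] .
  moreover have "inv\<^bsub>SL3\<lparr>carrier := P\<rparr>\<^esub> x = adj3 x" if "x \<in> P" for x
    using group.m_inv_consistent[OF group_SL3 P that] subgroup.subset[OF P] that
    by (auto simp: inv_SL3)
  ultimately show ?thesis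
    using assms(4) by (auto simp: PG.normal_inv_iff)
qed

lemma normal_subgroup_SL3D:
  assumes P: "subgroup P SL3" and N: "N \<lhd> SL3\<lparr>carrier := P\<rparr>"
  shows "N \<subseteq> P" "g \<in> N \<Longrightarrow> h \<in> N \<Longrightarrow> g ** h \<in> N"
    "x \<in> P \<Longrightarrow> h \<in> N \<Longrightarrow> x ** h ** adj3 x \<in> N"
proof -
  interpret PG: group "SL3\<lparr>carrier := P\<rparr>"
    using group.subgroup_imp_group[OF group_SL3 P] .
  have sub: "subgroup N (SL3\<lparr>carrier := P\<rparr>)" using PG.normal_invE(1)[OF N] .
  show "N \<subseteq> P" using subgroup.subset[OF sub] by simp
  show "g ** h \<in> N" if "g \<in> N" "h \<in> N"
    using subgroup.m_closed[OF sub that] by simp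
  show "x ** h ** adj3 x \<in> N" if x: "x \<in> P" and h: "h \<in> N"
  proof -
    have "inv\<^bsub>SL3\<lparr>carrier := P\<rparr>\<^esub> x = adj3 x"
      using group.m_inv_consistent[OF group_SL3 P x] subgroup.subset[OF P] x
      by (auto simp: inv_SL3)
    thus ?thesis using PG.normal_invE(2)[OF N, of x h] x h by simp
  qed
qed

lemma normal_U_alpha: "U_alpha \<lhd> SL3\<lparr>carrier := (P_alpha :: 'k::field mat3 set)\<rparr>"
proof (rule subgroup_SL3_normalI[OF subgroup_P_alpha _ U_alpha_P])
  show "subgroup (U_alpha :: 'k mat3 set) SL3"
    by (rule subgroup_SL3I) (auto simp: U_alpha_def det_3 mult_nth adj3_nth mat_1_nth)
  fix x h :: "'k mat3" assume x: "x \<in> P_alpha" and h: "h \<in> U_alpha"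
  have "(x ** adj3 x) $ i $ j = (mat 1 :: 'k mat3) $ i $ j" for i j
    using x by (simp add: P_alpha_def adj3_mult)
  from this[of 1 1] this[of 1 2] this[of 2 1] this[of 2 2] this[of 3 3]
  show "x ** h ** adj3 x \<in> U_alpha"
    using x h by (simp add: P_alpha_def U_alpha_def mult_nth adj3_nth mat_1_nth)
qed

lemma normal_U_beta: "U_beta \<lhd> SL3\<lparr>carrier := (P_beta :: 'k::field mat3 set)\<rparr>"
proof (rule subgroup_SL3_normalI[OF subgroup_P_beta _ U_beta_P])
  show "subgroup (U_beta :: 'k mat3 set) SL3"
    by (rule subgroup_SL3I) (auto simp: U_beta_def det_3 mult_nth adj3_nth mat_1_nth)
  fix x h :: "'k mat3" assume x: "x \<in> P_beta" and h: "h \<in> U_beta"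
  have "(x ** adj3 x) $ i $ j = (mat 1 :: 'k mat3) $ i $ j" for i j
    using x by (simp add: P_beta_def adj3_mult)
  from this[of 1 1] this[of 2 2] this[of 2 3] this[of 3 2] this[of 3 3]
  show "x ** h ** adj3 x \<in> U_beta"
    using x h by (simp add: P_beta_def U_beta_def mult_nth adj3_nth mat_1_nth algebra_simps)
qed

lemma unipotent_normal_P_alpha:
  fixes N :: "'k::field mat3 set"
  assumes two: "(2::'k) = 0"
    and N: "N \<lhd> SL3\<lparr>carrier := P_alpha\<rparr>" and unip: "\<And>g. g \<in> N \<Longrightarrow> unipotent_mat g"
  shows "N \<subseteq> U_alpha"
proof
  fix g assume g: "g \<in> N"
  note ND = normal_subgroup_SL3D[OF subgroup_P_alpha N]
  have block: "h$1$1 + h$2$2 = 0" "(h$1$1 - 1) * (h$2$2 - 1) = h$1$2 * h$2$1" if h: "h \<in> N" for h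
  proof -
    have P: "h$1$3 = 0" "h$2$3 = 0" using ND(1) h by (auto simp: P_alpha_def)
    note * = nilpotent_block[where x = "h - mat 1" and i = 1 and j = 2 and
        Q = "\<lambda>y. y$1$3 = 0 \<and> y$2$3 = 0", OF unip[OF h, unfolded unipotent_mat_def]]
    have "(h - mat 1)$1$1 + (h - mat 1)$2$2 = 0"
      by (rule *(1)) (auto simp: mult_nth mat_1_nth P)
    hence "h$1$1 + h$2$2 = 2" by (simp add: mat_1_nth algebra_simps)
    thus "h$1$1 + h$2$2 = 0" by (simp add: two)
    have "(h - mat 1)$1$1 * (h - mat 1)$2$2 = (h - mat 1)$1$2 * (h - mat 1)$2$1"
      by (rule *(2)) (auto simp: mult_nth mat_1_nth P)
    thus "(h$1$1 - 1) * (h$2$2 - 1) = h$1$2 * h$2$1" by (simp add: mat_1_nth)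
  qed
  have P: "g$1$3 = 0" "g$2$3 = 0" "det g = 1" using ND(1) g by (auto simp: P_alpha_def)
  define e :: "'k mat3" where "e = ray (unit_mat 2 1) 1"
  have "s_alpha \<in> P_alpha" "e \<in> P_alpha"
    by (simp_all add: P_alpha_def det_3 s_alpha_def e_def ray_nth)
  hence "g ** (s_alpha ** g ** adj3 s_alpha) \<in> N" "g ** (e ** g ** adj3 e) \<in> N"
    using g ND by blast+
  from block(1)[OF this(1)] block(1)[OF this(2)]
  have "2 * g$1$1 * g$2$2 - g$1$2 * g$1$2 - g$2$1 * g$2$1 = 0"
    "g$1$1 * g$1$1 + g$2$2 * g$2$2 + 2 * g$1$2 * g$2$1 - g$1$2 * g$1$2 = 0"
    by (simp_all add: mult_nth adj3_nth s_alpha_def e_def ray_nth P algebra_simps)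
  from block_trivial[OF two block[OF g] this] show "g \<in> U_alpha"
    using P by (simp add: U_alpha_def det_3)
qed

lemma unipotent_normal_P_beta:
  fixes N :: "'k::field mat3 set"
  assumes two: "(2::'k) = 0"
    and N: "N \<lhd> SL3\<lparr>carrier := P_beta\<rparr>" and unip: "\<And>g. g \<in> N \<Longrightarrow> unipotent_mat g"
  shows "N \<subseteq> U_beta"
proof
  fix g assume g: "g \<in> N"
  note ND = normal_subgroup_SL3D[OF subgroup_P_beta N]
  have block: "h$2$2 + h$3$3 = 0" "(h$2$2 - 1) * (h$3$3 - 1) = h$2$3 * h$3$2" if h: "h \<in> N" for h
  proof -
    have P: "h$1$2 = 0" "h$1$3 = 0" using ND(1) h by (auto simp: P_beta_def)
    note * = nilpotent_block[where x = "h - mat 1" and i = 2 and j = 3 and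
        Q = "\<lambda>y. y$1$2 = 0 \<and> y$1$3 = 0", OF unip[OF h, unfolded unipotent_mat_def]]
    have "(h - mat 1)$2$2 + (h - mat 1)$3$3 = 0"
      by (rule *(1)) (auto simp: mult_nth mat_1_nth P)
    hence "h$2$2 + h$3$3 = 2" by (simp add: mat_1_nth algebra_simps)
    thus "h$2$2 + h$3$3 = 0" by (simp add: two)
    have "(h - mat 1)$2$2 * (h - mat 1)$3$3 = (h - mat 1)$2$3 * (h - mat 1)$3$2"
      by (rule *(2)) (auto simp: mult_nth mat_1_nth P)
    thus "(h$2$2 - 1) * (h$3$3 - 1) = h$2$3 * h$3$2" by (simp add: mat_1_nth)
  qed
  have P: "g$1$2 = 0" "g$1$3 = 0" "det g = 1" using ND(1) g by (auto simp: P_beta_def)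
  define e :: "'k mat3" where "e = ray (unit_mat 3 2) 1"
  have "s_beta \<in> P_beta" "e \<in> P_beta"
    by (simp_all add: P_beta_def det_3 s_beta_def e_def ray_nth)
  hence "g ** (s_beta ** g ** adj3 s_beta) \<in> N" "g ** (e ** g ** adj3 e) \<in> N"
    using g ND by blast+
  from block(1)[OF this(1)] block(1)[OF this(2)]
  have "2 * g$2$2 * g$3$3 - g$2$3 * g$2$3 - g$3$2 * g$3$2 = 0"
    "g$2$2 * g$2$2 + g$3$3 * g$3$3 + 2 * g$2$3 * g$3$2 - g$2$3 * g$2$3 = 0"
    by (simp_all add: mult_nth adj3_nth s_beta_def e_def ray_nth P algebra_simps)
  from block_trivial[OF two block[OF g] this] show "g \<in> U_beta"
    using P by (simp add: U_beta_def det_3)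
qed

lemma zariski_closed_matrix_entries:
  fixes c :: "3 \<Rightarrow> 3 \<Rightarrow> 'k::field"
  shows "zariski_closed {g. \<forall>(i, j)\<in>I. g $ i $ j = c i j}"
proof (rule zariski_closedI)
  fix g :: "'k mat3" assume "g \<notin> {g. \<forall>(i, j)\<in>I. g $ i $ j = c i j}"
  then obtain i j where ij: "(i, j) \<in> I" "g $ i $ j \<noteq> c i j" by blast
  have "(\<lambda>g :: 'k mat3. g $ i $ j - c i j) \<in> polyfun" by (intro polyfun_intros)
  thus "\<exists>F\<in>polyfun. (\<forall>h\<in>{g. \<forall>(i, j)\<in>I. g $ i $ j = c i j}. F h = 0) \<and> F g \<noteq> 0"
    using ij by (intro bexI[of _ "\<lambda>g. g $ i $ j - c i j"]) auto
qed

lemma unipotent_square_zero: "(g - mat 1) ** (g - mat 1) = 0 \<Longrightarrow> unipotent_mat (g :: 'k::field mat3)"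
  unfolding unipotent_mat_def nilpotent_mat_def
  by (intro exI[of _ 2]) (simp add: numeral_2_eq_2)

lemma unipotent_radical_P_alpha:
  assumes "(2::'k::alg_closed_field) = 0"
  shows "unipotent_radical (P_alpha :: 'k mat3 set) = U_alpha"
proof
  show "unipotent_radical (P_alpha :: 'k mat3 set) \<subseteq> U_alpha"
    using unipotent_normal_P_alpha[OF assms] unfolding unipotent_radical_def by blast
  have "zariski_closed (U_alpha :: 'k mat3 set)"
    using zariski_closed_matrix_entries[of "{(1,1),(2,2),(3,3),(1,2),(1,3),(2,1),(2,3)}"
        "\<lambda>i j. if i = j then 1 else 0 :: 'k"]
    by (simp add: U_alpha_def)
  moreover have "zariski_connected (U_alpha :: 'k mat3 set)"
    by (rule zariski_connected_affine) (auto simp: U_alpha_def)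
  moreover have "unipotent_mat g" if "g \<in> U_alpha" for g :: "'k mat3"
    using that by (intro unipotent_square_zero)
      (simp add: vec_eq_iff forall_3 mult_nth mat_1_nth U_alpha_def)
  ultimately show "U_alpha \<subseteq> unipotent_radical (P_alpha :: 'k mat3 set)"
    using normal_U_alpha unfolding unipotent_radical_def by blast
qed

lemma unipotent_radical_P_beta:
  assumes "(2::'k::alg_closed_field) = 0"
  shows "unipotent_radical (P_beta :: 'k mat3 set) = U_beta"
proof
  show "unipotent_radical (P_beta :: 'k mat3 set) \<subseteq> U_beta"
    using unipotent_normal_P_beta[OF assms] unfolding unipotent_radical_def by blast
  have "zariski_closed (U_beta :: 'k mat3 set)"
    using zariski_closed_matrix_entries[of "{(1,1),(2,2),(3,3),(1,2),(1,3),(2,3),(3,2)}"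
        "\<lambda>i j. if i = j then 1 else 0 :: 'k"]
    by (simp add: U_beta_def)
  moreover have "zariski_connected (U_beta :: 'k mat3 set)"
    by (rule zariski_connected_affine) (auto simp: U_beta_def)
  moreover have "unipotent_mat g" if "g \<in> U_beta" for g :: "'k mat3"
    using that by (intro unipotent_square_zero)
      (simp add: vec_eq_iff forall_3 mult_nth mat_1_nth U_beta_def)
  ultimately show "U_beta \<subseteq> unipotent_radical (P_beta :: 'k mat3 set)"
    using normal_U_beta unfolding unipotent_radical_def by blast
qed

lemma u_alpha_eq:
  assumes "(2::'k::alg_closed_field) = 0"
  shows "(u_alpha :: 'k mat3 set) = {x \<in> null_lower. x$2$1 = 0}"
proof (intro equalityI subsetI)
  fix x :: "'k mat3" assume "x \<in> u_alpha"
  hence L: "x \<in> Lie U_alpha" by (simp add: u_alpha_def unipotent_radical_P_alpha[OF assms])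
  have "x$1$1 = 0" "x$2$2 = 0" "x$3$3 = 0" "x$1$2 = 0" "x$1$3 = 0" "x$2$1 = 0" "x$2$3 = 0"
    by (rule Lie_entry[OF L], force simp: U_alpha_def)+
  thus "x \<in> {x \<in> null_lower. x$2$1 = 0}" by (simp add: null_lower_def)
next
  fix x :: "'k mat3" assume "x \<in> {x \<in> null_lower. x$2$1 = 0}"
  hence "ray x t \<in> U_alpha" for t by (auto simp: null_lower_def U_alpha_def ray_nth)
  thus "x \<in> u_alpha" using Lie_ray by (auto simp: u_alpha_def unipotent_radical_P_alpha[OF assms])
qed

lemma u_beta_eq:
  assumes "(2::'k::alg_closed_field) = 0"
  shows "(u_beta :: 'k mat3 set) = {x \<in> null_lower. x$3$2 = 0}"
proof (intro equalityI subsetI)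
  fix x :: "'k mat3" assume "x \<in> u_beta"
  hence L: "x \<in> Lie U_beta" by (simp add: u_beta_def unipotent_radical_P_beta[OF assms])
  have "x$1$1 = 0" "x$2$2 = 0" "x$3$3 = 0" "x$1$2 = 0" "x$1$3 = 0" "x$2$3 = 0" "x$3$2 = 0"
    by (rule Lie_entry[OF L], force simp: U_beta_def)+
  thus "x \<in> {x \<in> null_lower. x$3$2 = 0}" by (simp add: null_lower_def)
next
  fix x :: "'k mat3" assume "x \<in> {x \<in> null_lower. x$3$2 = 0}"
  hence "ray x t \<in> U_beta" for t by (auto simp: null_lower_def U_beta_def ray_nth)
  thus "x \<in> u_beta" using Lie_ray by (auto simp: u_beta_def unipotent_radical_P_beta[OF assms])
qed

lemma u_alpha_Un_u_beta:
  assumes "(2::'k::alg_closed_field) = 0"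
  shows "(u_alpha \<union> u_beta :: 'k mat3 set) = null_lower"
  unfolding u_alpha_eq[OF assms] u_beta_eq[OF assms] by (auto simp: null_lower_def)

section \<open>Preimages of Schubert varieties\<close>

lemma zariski_closed_SL3_entries:
  "zariski_closed {g :: 'k::field mat3. det g = 1 \<and> (\<forall>(i, j)\<in>I. g $ i $ j = 0)}"
proof -
  have "{g :: 'k mat3. det g = 1 \<and> (\<forall>(i, j)\<in>I. g $ i $ j = 0)} =
      {g. \<forall>F\<in>insert (\<lambda>g. det g - 1) ((\<lambda>(i, j) g. g $ i $ j) ` I). F g = 0}"
    by (auto simp: case_prod_unfold)
  thus ?thesis
    by (simp only:, intro zariski_closed_equations)
       (auto intro!: polyfun_diff polyfun_det polyfun.intros)
qed

lemma schubert_preimage_eqI: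
  assumes "zariski_closed Y" "subgroup Y SL3" "Borel \<subseteq> Y" "w \<in> Y"
    and "\<And>F g. F \<in> polyfun \<Longrightarrow> g \<in> Y \<Longrightarrow>
      (\<And>b b'. b \<in> Borel \<Longrightarrow> b' \<in> Borel \<Longrightarrow> F (b ** w ** b') = 0) \<Longrightarrow> F g = 0"
  shows "schubert_preimage w = Y"
proof
  have "g ** h \<in> Y" if "g \<in> Y" "h \<in> Y" for g h
    using subgroup.m_closed[OF assms(2) that] by simp
  hence "{b ** w ** b' | b b'. b \<in> Borel \<and> b' \<in> Borel} \<subseteq> Y"
    using assms(3,4) by blast
  hence "schubert_preimage w \<subseteq> zariski_closure Y"
    unfolding schubert_preimage_def zariski_closure_def by blast
  thus "schubert_preimage w \<subseteq> Y" using assms(1) by (simp add: zariski_closed_def)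
  show "Y \<subseteq> schubert_preimage w"
    using assms(5) unfolding schubert_preimage_def zariski_closure_def by blast
qed

lemma vanish_on_cell:
  assumes F: "\<And>b b'. b \<in> Borel \<Longrightarrow> b' \<in> Borel \<Longrightarrow> F (b ** w ** b') = 0"
    and w: "det w = 1" and b: "b \<in> Borel" and g: "adj3 w ** (b ** g) \<in> Borel"
  shows "F g = 0"
proof -
  have det_b: "det b = 1" using b by (simp add: Borel_def)
  have "adj3 b \<in> Borel"
    using subgroup.m_inv_closed[OF subgroup_Borel b] det_b by (simp add: inv_SL3)
  hence "F (adj3 b ** w ** (adj3 w ** (b ** g))) = 0" using F g by blast
  also have "adj3 b ** w ** (adj3 w ** (b ** g)) = adj3 b ** (w ** adj3 w) ** b ** g"
    by (simp only: matrix_mul_assoc)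
  also have "\<dots> = g" by (simp add: adj3_mult w det_b)
  finally show ?thesis .
qed

lemma det_ray_unit: "i \<noteq> j \<Longrightarrow> det (ray (unit_mat i j) t) = 1"
  using exhaust_3[of i] exhaust_3[of j] by (auto simp: det_3 ray_nth)

lemma unit_mat_square: "i \<noteq> j \<Longrightarrow> unit_mat i j ** unit_mat i j = 0"
  using exhaust_3[of i] exhaust_3[of j] by (auto simp: vec_eq_iff forall_3 mult_nth)

lemma det_s: "det (s_alpha :: 'k::field mat3) = 1" "det (s_beta :: 'k::field mat3) = 1"
  by (simp_all add: det_3 s_alpha_def s_beta_def)

lemma schubert_preimage_e: "schubert_preimage (mat 1) = (Borel :: 'k::field mat3 set)"
proof (rule schubert_preimage_eqI[OF _ subgroup_Borel])
  show "zariski_closed (Borel :: 'k mat3 set)"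
    using zariski_closed_SL3_entries[of "{(1,2),(1,3),(2,3)}"] by (simp add: Borel_def)
  show one: "(mat 1 :: 'k mat3) \<in> Borel" by (simp add: Borel_iff mat_1_nth)
  fix F :: "'k mat3 \<Rightarrow> 'k" and g :: "'k mat3"
  assume "g \<in> Borel" and F: "\<And>b b'. b \<in> Borel \<Longrightarrow> b' \<in> Borel \<Longrightarrow> F (b ** mat 1 ** b') = 0"
  show "F g = 0" using F[OF \<open>g \<in> Borel\<close> one] by simp
qed simp

text \<open>
  The cell \<open>B s\<^sub>\<alpha> B\<close> is the part of \<open>P_alpha\<close> where the entry at \<open>(1, 2)\<close> is nonzero. Every point outside
  the cell lies on a line that otherwise stays inside it.
\<close>

lemma schubert_preimage_s_alpha:
  "schubert_preimage s_alpha = (P_alpha :: 'k::alg_closed_field mat3 set)"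
proof (rule schubert_preimage_eqI[OF _ subgroup_P_alpha])
  show "zariski_closed (P_alpha :: 'k mat3 set)"
    using zariski_closed_SL3_entries[of "{(1,3),(2,3)}"] by (simp add: P_alpha_def)
  show "Borel \<subseteq> (P_alpha :: 'k mat3 set)" by (rule Borel_subset_P)
  show "(s_alpha :: 'k mat3) \<in> P_alpha" by (simp add: P_alpha_def det_s) (simp add: s_alpha_def)
  fix F :: "'k mat3 \<Rightarrow> 'k" and g :: "'k mat3"
  assume poly: "F \<in> polyfun" and g: "g \<in> P_alpha"
    and F: "\<And>b b'. b \<in> Borel \<Longrightarrow> b' \<in> Borel \<Longrightarrow> F (b ** s_alpha ** b') = 0"
  have cell: "F g = 0" if g: "g \<in> P_alpha" "g$1$2 \<noteq> 0" for g
  proof (rule vanish_on_cell[where F = F, OF F det_s(1)])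
    let ?b = "ray (unit_mat 2 1) (- (g$2$2 / g$1$2)) :: 'k mat3"
    show b: "?b \<in> Borel" by (simp add: Borel_iff ray_nth)
    show "adj3 s_alpha ** (?b ** g) \<in> Borel"
      unfolding Borel_def using g
      by (simp add: det_mul det_adj3 det_s det_ray_unit P_alpha_def)
         (simp add: mult_nth ray_nth adj3_nth s_alpha_def field_simps)
  qed
  show "F g = 0"
  proof (cases "g$1$2 = 0")
    case True
    show ?thesis
    proof (rule polyfun_zero_limit[OF poly, of "unit_mat 1 2"])
      fix t :: 'k assume "t \<noteq> 0"
      moreover have "g$2$2 \<noteq> 0" using g True by (auto simp: P_alpha_def det_3)
      ultimately show "F (ray (unit_mat 1 2) t ** g) = 0"
        using g True
        by (intro cell) (simp_all add: P_alpha_def det_mul det_ray_unit mult_nth ray_nth)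
    qed
  qed (use cell g in auto)
qed

lemma schubert_preimage_s_beta:
  "schubert_preimage s_beta = (P_beta :: 'k::alg_closed_field mat3 set)"
proof (rule schubert_preimage_eqI[OF _ subgroup_P_beta])
  show "zariski_closed (P_beta :: 'k mat3 set)"
    using zariski_closed_SL3_entries[of "{(1,2),(1,3)}"] by (simp add: P_beta_def)
  show "Borel \<subseteq> (P_beta :: 'k mat3 set)" by (rule Borel_subset_P)
  show "(s_beta :: 'k mat3) \<in> P_beta" by (simp add: P_beta_def det_s) (simp add: s_beta_def)
  fix F :: "'k mat3 \<Rightarrow> 'k" and g :: "'k mat3"
  assume poly: "F \<in> polyfun" and g: "g \<in> P_beta"
    and F: "\<And>b b'. b \<in> Borel \<Longrightarrow> b' \<in> Borel \<Longrightarrow> F (b ** s_beta ** b') = 0"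
  have cell: "F g = 0" if g: "g \<in> P_beta" "g$2$3 \<noteq> 0" for g
  proof (rule vanish_on_cell[where F = F, OF F det_s(2)])
    let ?b = "ray (unit_mat 3 2) (- (g$3$3 / g$2$3)) :: 'k mat3"
    show b: "?b \<in> Borel" by (simp add: Borel_iff ray_nth)
    show "adj3 s_beta ** (?b ** g) \<in> Borel"
      unfolding Borel_def using g
      by (simp add: det_mul det_adj3 det_s det_ray_unit P_beta_def)
         (simp add: mult_nth ray_nth adj3_nth s_beta_def field_simps)
  qed
  show "F g = 0"
  proof (cases "g$2$3 = 0")
    case True
    show ?thesis
    proof (rule polyfun_zero_limit[OF poly, of "unit_mat 2 3"])
      fix t :: 'k assume "t \<noteq> 0"
      moreover have "g$3$3 \<noteq> 0" using g True by (auto simp: P_beta_def det_3)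
      ultimately show "F (ray (unit_mat 2 3) t ** g) = 0"
        using g True
        by (intro cell) (simp_all add: P_beta_def det_mul det_ray_unit mult_nth ray_nth)
    qed
  qed (use cell g in auto)
qed

lemma subgroup_carrier_SL3: "subgroup (carrier SL3) (SL3 :: 'k::field mat3 monoid)"
  using group.subgroup_self[OF group_SL3] .

text \<open>
  The big cell is given by the nonvanishing of two minors: the entry at \<open>(1, 3)\<close>, and the minor \<open>m\<close> with
  rows 1, 2 and columns 2, 3. An arbitrary element is moved into it along lines in three steps, which
  make first the minor \<open>m'\<close> with rows 1, 3, then \<open>m\<close>, then the entry nonzero.
\<close>

lemma schubert_preimage_longest:
  "schubert_preimage (s_alpha ** s_beta ** s_alpha) = (carrier SL3 :: 'k::alg_closed_field mat3 set)"
proof (rule schubert_preimage_eqI[OF _ subgroup_carrier_SL3])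
  let ?w = "s_alpha ** s_beta ** s_alpha :: 'k mat3"
  have w: "?w $ 1 $ 1 = 0" "?w $ 1 $ 2 = 0" "?w $ 1 $ 3 = 1" "?w $ 2 $ 1 = 0" "?w $ 2 $ 2 = -1"
    "?w $ 2 $ 3 = 0" "?w $ 3 $ 1 = 1" "?w $ 3 $ 2 = 0" "?w $ 3 $ 3 = 0"
    by (simp_all add: mult_nth) (simp_all add: s_alpha_def s_beta_def)
  show "zariski_closed (carrier SL3 :: 'k mat3 set)"
    using zariski_closed_SL3_entries[of "{}"] by (simp add: SL3_def)
  show "Borel \<subseteq> (carrier SL3 :: 'k mat3 set)" by (rule Borel_subset_SL3)
  show "?w \<in> carrier SL3" by (simp add: det_mul det_s)
  hence det_w: "det ?w = 1" by simp
  fix F :: "'k mat3 \<Rightarrow> 'k" and g :: "'k mat3"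
  assume poly: "F \<in> polyfun" and g: "g \<in> carrier SL3"
    and F: "\<And>b b'. b \<in> Borel \<Longrightarrow> b' \<in> Borel \<Longrightarrow> F (b ** ?w ** b') = 0"
  define m where "m g = g$1$2 * g$2$3 - g$1$3 * g$2$2" for g :: "'k mat3"
  have cell: "F g = 0" if g: "det g = 1" "g$1$3 \<noteq> 0" "m g \<noteq> 0" for g
  proof (rule vanish_on_cell[where F = F, OF F det_w])
    \<comment> \<open>\<open>b\<close> is row elimination: it clears the entries of \<open>g\<close> at (2, 3), (3, 2) and (3, 3)\<close>
    define p where "p = - (g$3$2 * g$2$3 - g$3$3 * g$2$2) / m g"
    define q where "q = - (g$1$2 * g$3$3 - g$1$3 * g$3$2) / m g"
    define b :: "'k mat3" where
      "b = vector [vector [1, 0, 0], vector [- (g$2$3 / g$1$3), 1, 0], vector [p, q, 1]]"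
    have b_nth: "b$1$1 = 1" "b$1$2 = 0" "b$1$3 = 0" "b$2$1 = - (g$2$3 / g$1$3)" "b$2$2 = 1" "b$2$3 = 0"
      "b$3$1 = p" "b$3$2 = q" "b$3$3 = 1" by (simp_all add: b_def)
    show b: "b \<in> Borel" by (simp add: Borel_iff b_nth)
    hence det_b: "det b = 1" by (simp add: Borel_def)
    have pq: "p * g$1$2 + q * g$2$2 + g$3$2 = 0" "p * g$1$3 + q * g$2$3 + g$3$3 = 0"
      using g(3) by (simp_all add: p_def q_def field_simps) (simp_all add: m_def algebra_simps)
    show "adj3 ?w ** (b ** g) \<in> Borel"
      unfolding Borel_def using g pq
      by (simp add: det_mul det_adj3 det_s det_w det_b)
         (simp add: mult_nth[of _ "b ** g"] adj3_nth w mult_nth[of b] b_nth)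
  qed
  have minor: "F g = 0" if g: "det g = 1" "m g \<noteq> 0" for g
  proof (cases "g$1$3 = 0")
    case True
    show ?thesis
    proof (rule polyfun_zero_limit[OF poly, of "unit_mat 1 2"])
      fix t :: 'k assume "t \<noteq> 0"
      moreover have "g$2$3 \<noteq> 0" using g(2) True by (auto simp: m_def)
      moreover have "m (ray (unit_mat 1 2) t ** g) = m g"
        by (simp add: m_def mult_nth ray_nth algebra_simps)
      ultimately show "F (ray (unit_mat 1 2) t ** g) = 0"
        using g True by (intro cell) (simp_all add: det_mul det_ray_unit mult_nth ray_nth)
    qed
  qed (use cell g in auto)
  define m' where "m' g = g$1$2 * g$3$3 - g$1$3 * g$3$2" for g :: "'k mat3"
  have minor': "F g = 0" if g: "det g = 1" "m' g \<noteq> 0" for g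
  proof (cases "m g = 0")
    case True
    show ?thesis
    proof (rule polyfun_zero_limit[OF poly, of "unit_mat 2 3"])
      fix t :: 'k assume "t \<noteq> 0"
      moreover have "m (ray (unit_mat 2 3) t ** g) = m g + t * m' g"
        by (simp add: m_def m'_def mult_nth ray_nth algebra_simps)
      ultimately show "F (ray (unit_mat 2 3) t ** g) = 0"
        using g True by (intro minor) (simp_all add: det_mul det_ray_unit)
    qed
  qed (use minor g in auto)
  have det: "det g = 1" using g by simp
  show "F g = 0"
  proof (cases "m g = 0 \<and> m' g = 0")
    case True
    show ?thesis
    proof (rule polyfun_zero_limit[OF poly, of "unit_mat 1 2"])
      fix t :: 'k assume "t \<noteq> 0"
      moreover have "m' (ray (unit_mat 1 2) t ** g) = m' g + t * (g$2$2 * g$3$3 - g$2$3 * g$3$2)"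
        by (simp add: m'_def mult_nth ray_nth algebra_simps)
      moreover have "g$1$1 * (g$2$2 * g$3$3 - g$2$3 * g$3$2) - g$2$1 * m' g + g$3$1 * m g = 1"
        using det by (simp add: det_3 m_def m'_def algebra_simps)
      hence "g$2$2 * g$3$3 - g$2$3 * g$3$2 \<noteq> 0" using True by auto
      ultimately show "F (ray (unit_mat 1 2) t ** g) = 0"
        using det True by (intro minor') (simp_all add: det_mul det_ray_unit)
    qed
  qed (use minor minor' det in auto)
qed

section \<open>The action of square-zero elements on sections\<close>

lemma inverse_wt_char:
  assumes "dominant lam" "b \<in> Borel"
  shows "inverse (wt_char lam b) = (b$2$2 * b$3$3) ^ nat (fst lam) * b$3$3 ^ nat (snd lam)"
proof -
  have "b$1$1 * (b$2$2 * b$3$3) = 1" "b$1$1 * b$2$2 * b$3$3 = 1"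
    using assms(2) by (simp_all add: Borel_iff mult.assoc)
  hence "inverse (b$1$1) = b$2$2 * b$3$3" "inverse (b$1$1 * b$2$2) = b$3$3"
    by (simp_all only: inverse_unique)
  moreover have "inverse (x powi k * y powi l) = inverse x ^ nat k * inverse y ^ nat l"
    if "k \<ge> 0" "l \<ge> 0" for x y :: 'a and k l
    using that by (simp add: power_int_def power_inverse)
  ultimately show ?thesis
    using assms(1) by (simp only: wt_char_def dominant_def)
qed

definition ray_act :: "'k::field mat3 \<Rightarrow> ('k mat3 \<Rightarrow> 'k) \<Rightarrow> 'k mat3 \<Rightarrow> 'k" where
  "ray_act x f = (\<lambda>g. lin_coeff (\<lambda>t. f (ray x t ** g)))"

lemma ray_act_eq:
  fixes q :: "'k::alg_closed_field poly"
  assumes "\<And>t. poly q t = f (ray x t ** g)"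
  shows "ray_act x f g = poly (pderiv q) 0"
  unfolding ray_act_def by (rule lin_coeff_eq) (rule assms)

text \<open>
  Since \<open>1 + t x\<close> is a one-parameter subgroup, acting by \<open>x\<close> differentiates the restriction of \<open>f\<close> to its orbits.
\<close>

lemma ray_act_ray:
  fixes q :: "'k::alg_closed_field poly"
  assumes "x ** x = 0" "\<And>t. poly q t = f (ray x t ** g)"
  shows "ray_act x f (ray x u ** g) = poly (pderiv q) u"
proof -
  have "ray x t ** (ray x u ** g) = ray x (u + t) ** g" for t
    using ray_add[OF assms(1), of t u] by (simp add: matrix_mul_assoc add.commute)
  hence "poly (pcompose q [:u, 1:]) t = f (ray x t ** (ray x u ** g))" for t
    by (simp add: poly_pcompose assms(2) mult.commute)
  from ray_act_eq[OF this] show ?thesis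
    by (simp add: pderiv_pcompose poly_pcompose pderiv_pCons)
qed

lemma pderiv_sum: "pderiv (sum f A) = (\<Sum>i\<in>A. pderiv (f i))"
  by (induction A rule: infinite_finite_induct) (simp_all add: pderiv_add)

lemma sum_index_coeff:
  "(\<Sum>i\<le>degree q. of_nat i * (coeff q i * r ^ i)) = r * poly (pderiv q) (r :: 'k::field)"
proof -
  have "pderiv q = pderiv (\<Sum>i\<le>degree q. monom (coeff q i) i)"
    by (simp add: poly_as_sum_of_monoms)
  also have "r * poly \<dots> r = (\<Sum>i\<le>degree q. r * poly (pderiv (monom (coeff q i) i)) r)"
    by (simp add: pderiv_sum poly_sum sum_distrib_left)
  also have "\<dots> = (\<Sum>i\<le>degree q. of_nat i * (coeff q i * r ^ i))"
  proof (rule sum.cong[OF refl])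
    fix i
    show "r * poly (pderiv (monom (coeff q i) i)) r = of_nat i * (coeff q i * r ^ i)"
      by (cases i) (simp_all add: pderiv_monom poly_monom algebra_simps)
  qed
  finally show ?thesis by simp
qed

text \<open>
  The action of \<open>c E\<^sub>2\<^sub>1\<close> on sections of degree \<open>n\<close>, written in the affine coordinate \<open>r\<close> of the projective
  line. The hypothesis holds only where the denominator is nonzero, so the identity is first multiplied
  by a power of \<open>1 + t c r\<close> and then compared at order one in \<open>t\<close>.
\<close>

lemma chart_derivative:
  fixes Q q :: "'k::alg_closed_field poly"
  assumes Q: "\<And>t. 1 + t * c * r \<noteq> 0 \<Longrightarrow>
               poly Q t = (1 + t * c * r) ^ n * poly q (r / (1 + t * c * r))"
  shows "poly (pderiv Q) 0 = c * (of_nat n * r * poly q r - r ^ 2 * poly (pderiv q) r)"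
proof -
  define d where "d = degree q"
  define v where "v = [:1, c * r:]"
  define R where "R = (\<Sum>i\<le>d. smult (coeff q i * r ^ i) (v ^ (d - i)))"
  have v: "poly v t = 1 + t * c * r" for t by (simp add: v_def algebra_simps)
  have "v \<noteq> 0" by (simp add: v_def)
  have eq: "v ^ d * Q = v ^ n * R"
  proof (rule poly_eqI_cofinite[OF poly_roots_finite[OF \<open>v \<noteq> 0\<close>]])
    fix t assume "t \<notin> {t. poly v t = 0}"
    hence nz: "poly v t \<noteq> 0" by simp
    have "poly v t ^ d * poly q (r / poly v t) =
        (\<Sum>i\<le>d. coeff q i * r ^ i * poly v t ^ (d - i))"
      unfolding poly_altdef[of q] d_def[symmetric] sum_distrib_left
      using nz by (intro sum.cong) (auto simp: power_divide power_diff field_simps)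
    thus "poly (v ^ d * Q) t = poly (v ^ n * R) t"
      using Q[of t] nz by (simp add: R_def poly_sum flip: v)
  qed
  have v_power: "poly (pderiv (v ^ k)) 0 = of_nat k * (c * r)" for k
    by (simp add: pderiv_power v) (simp add: v_def pderiv_pCons)
  have R0: "poly R 0 = poly q r"
    by (simp add: R_def poly_sum v poly_altdef[of q] d_def)
  have "poly Q 0 = poly q r" using Q[of 0] by simp
  hence "poly (pderiv (v ^ d * Q)) 0 = of_nat d * (c * r) * poly q r + poly (pderiv Q) 0"
    by (simp add: pderiv_mult v v_power)
  moreover have "poly (pderiv (v ^ n * R)) 0 = of_nat n * (c * r) * poly q r + poly (pderiv R) 0"
    by (simp add: pderiv_mult v v_power R0)
  moreover have "poly (pderiv R) 0 = of_nat d * (c * r) * poly q r - c * r * (r * poly (pderiv q) r)"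
  proof -
    have "poly (pderiv R) 0 = (\<Sum>i\<le>d. coeff q i * r ^ i * (of_nat (d - i) * (c * r)))"
    by (simp add: R_def pderiv_sum poly_sum pderiv_smult v_power)
  also have "\<dots> = (\<Sum>i\<le>d. of_nat d * (c * r) * (coeff q i * r ^ i)
                          - c * r * (of_nat i * (coeff q i * r ^ i)))"
    by (intro sum.cong) (auto simp: of_nat_diff algebra_simps)
  also have "\<dots> = of_nat d * (c * r) * poly q r - c * r * (r * poly (pderiv q) r)"
    by (simp only: sum_subtractf flip: sum_distrib_left)
       (simp add: poly_altdef[of q] d_def sum_index_coeff)
    finally show ?thesis .
  qed
  ultimately have "of_nat d * (c * r) * poly q r + poly (pderiv Q) 0 = of_nat n * (c * r) * poly q r
      + (of_nat d * (c * r) * poly q r - c * r * (r * poly (pderiv q) r))"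
    using eq by simp
  hence "poly (pderiv Q) 0 = of_nat n * (c * r) * poly q r - c * r * (r * poly (pderiv q) r)"
    by simp
  thus ?thesis by (simp add: algebra_simps power2_eq_square)
qed

text \<open>
  Sections over a Schubert variety whose preimage is a group; this covers all four cases of the theorem.
\<close>

locale schubert_sections =
  fixes Y :: "'k::alg_closed_field mat3 set" and lam :: weight
  assumes two: "(2::'k) = 0"
    and dominant: "dominant lam"
    and Y: "subgroup Y SL3" "Borel \<subseteq> Y"
begin

abbreviation M :: "('k mat3 \<Rightarrow> 'k) set" where "M \<equiv> line_sections Y lam"

lemma det_Y: "g \<in> Y \<Longrightarrow> det g = 1"
  using subgroup.subset[OF Y(1)] by auto

lemma mult_Y: "g \<in> Y \<Longrightarrow> h \<in> Y \<Longrightarrow> g ** h \<in> Y"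
  using subgroup.m_closed[OF Y(1)] by simp

lemma adj3_Y: "g \<in> Y \<Longrightarrow> adj3 g \<in> Y"
  using subgroup.m_inv_closed[OF Y(1)] det_Y by (simp add: inv_SL3)

lemma mult_Y_iff:
  assumes "h \<in> Y"
  shows "h ** g \<in> Y \<longleftrightarrow> g \<in> Y"
proof
  assume "h ** g \<in> Y"
  hence "adj3 h ** (h ** g) \<in> Y" by (rule mult_Y[OF adj3_Y[OF assms]])
  thus "g \<in> Y" by (simp add: matrix_mul_assoc adj3_mult(1)[OF det_Y[OF assms]])
qed (rule mult_Y[OF assms])

lemma one_Y: "mat 1 \<in> Y"
  using subgroup.one_closed[OF Y(1)] by simp

lemma section_Borel:
  assumes "f \<in> M" "g \<in> Y" "b \<in> Borel"
  shows "f (g ** b) = (b$2$2 * b$3$3) ^ nat (fst lam) * b$3$3 ^ nat (snd lam) * f g"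
proof -
  have "f (g ** b) = inverse (wt_char lam b) * f g"
    using assms unfolding line_sections_def by blast
  thus ?thesis by (simp only: inverse_wt_char[OF dominant assms(3)])
qed

lemma section_0: "f \<in> M \<Longrightarrow> g \<notin> Y \<Longrightarrow> f g = 0"
  by (simp add: line_sections_def)

lemma section_polyfun: "f \<in> M \<Longrightarrow> \<exists>F\<in>polyfun. \<forall>g\<in>Y. f g = F g"
  by (simp add: line_sections_def regular_on_def)

lemma sectionI:
  assumes "F \<in> polyfun" "\<And>g. g \<in> Y \<Longrightarrow> f g = F g" "\<And>g. g \<notin> Y \<Longrightarrow> f g = 0"
    and "\<And>g b. g \<in> Y \<Longrightarrow> b \<in> Borel \<Longrightarrow>
      F (g ** b) = (b$2$2 * b$3$3) ^ nat (fst lam) * b$3$3 ^ nat (snd lam) * F g"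
  shows "f \<in> M"
  using assms Y(2) by (auto simp: line_sections_def regular_on_def inverse_wt_char[OF dominant] mult_Y)

lemma section_ray_poly:
  assumes "f \<in> M" "\<And>t. ray x t \<in> Y"
  shows "\<exists>q. \<forall>t. poly q t = f (ray x t ** g)"
proof (cases "g \<in> Y")
  case True
  obtain F where F: "F \<in> polyfun" "\<And>g. g \<in> Y \<Longrightarrow> f g = F g"
    using section_polyfun[OF assms(1)] by blast
  obtain q where "\<And>t. poly q t = F (ray x t ** g)"
    unfolding ray_mult using polyfun_line[OF F(1)] by blast
  thus ?thesis using F(2) mult_Y[OF assms(2) True] by auto
next
  case False
  hence "f (ray x t ** g) = 0" for t
    using section_0[OF assms(1)] mult_Y_iff[OF assms(2)] by blast
  thus ?thesis by (intro exI[of _ 0]) simp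
qed

lemma subspace_M: "fun_space.subspace M"
proof (rule fun_space.subspaceI)
  show "0 \<in> M" by (rule sectionI[of "\<lambda>_. 0"]) (auto intro: polyfun.const)
next
  fix f f' assume *: "f \<in> M" "f' \<in> M"
  then obtain F F' where "F \<in> polyfun" "\<forall>g\<in>Y. f g = F g" "F' \<in> polyfun" "\<forall>g\<in>Y. f' g = F' g"
    using section_polyfun by metis
  with * show "f + f' \<in> M"
    by (auto simp: line_sections_def regular_on_def algebra_simps
        intro!: bexI[of _ "\<lambda>g. F g + F' g"] polyfun.add)
next
  fix c f assume *: "f \<in> M"
  then obtain F where "F \<in> polyfun" "\<forall>g\<in>Y. f g = F g"
    using section_polyfun by metis
  with * show "scale_fun c f \<in> M"
    by (auto simp: line_sections_def regular_on_def scale_fun_def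
        intro!: bexI[of _ "\<lambda>g. c * F g"] polyfun.mult polyfun.const)
qed

lemma ray_act_section:
  assumes f: "f \<in> M" and x: "\<And>t. ray x t \<in> Y"
  shows "ray_act x f \<in> M"
proof -
  obtain F where F: "F \<in> polyfun" "\<And>g. g \<in> Y \<Longrightarrow> f g = F g"
    using section_polyfun[OF f] by blast
  obtain D where D: "D \<in> polyfun"
    "\<And>g. \<exists>q. (\<forall>t. poly q t = F (ray x t ** g)) \<and> poly (pderiv q) 0 = D g"
    using polyfun_derivation[OF F(1)] by blast
  have act: "ray_act x f g = D g" if "g \<in> Y" for g
  proof -
    obtain q where "\<And>t. poly q t = F (ray x t ** g)" "poly (pderiv q) 0 = D g"
      using D(2)[of g] by blast
    thus ?thesis using ray_act_eq[of q f x g] F(2) mult_Y[OF x that] by simp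
  qed
  have "ray_act x f (g ** b) = (b$2$2 * b$3$3) ^ nat (fst lam) * b$3$3 ^ nat (snd lam) * ray_act x f g"
    if "g \<in> Y" "b \<in> Borel" for g b
  proof -
    let ?l = "(b$2$2 * b$3$3) ^ nat (fst lam) * b$3$3 ^ nat (snd lam)"
    obtain q where q: "\<And>t. poly q t = f (ray x t ** g)"
      using section_ray_poly[OF f x] by blast
    have "poly (smult ?l q) t = f (ray x t ** (g ** b))" for t
      using section_Borel[OF f mult_Y[OF x \<open>g \<in> Y\<close>] \<open>b \<in> Borel\<close>]
      by (simp add: q matrix_mul_assoc)
    from ray_act_eq[OF this] ray_act_eq[OF q] show ?thesis by (simp add: pderiv_smult)
  qed
  moreover have "ray_act x f g = 0" if "g \<notin> Y" for g
    using ray_act_eq[of 0 f x g] section_0[OF f] mult_Y_iff[OF x] that by simp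
  moreover have "g ** b \<in> Y" if "g \<in> Y" "b \<in> Borel" for g b
    using mult_Y that Y(2) by blast
  ultimately show ?thesis
    using D(1) by (intro sectionI[of D]) (simp_all flip: act)
qed

lemma ray_act_add:
  assumes "f \<in> M" "f' \<in> M" "\<And>t. ray x t \<in> Y"
  shows "ray_act x (f + f') = ray_act x f + ray_act x f'"
proof
  fix g
  obtain q q' where "\<And>t. poly q t = f (ray x t ** g)" "\<And>t. poly q' t = f' (ray x t ** g)"
    using section_ray_poly assms by metis
  thus "ray_act x (f + f') g = (ray_act x f + ray_act x f') g"
    using ray_act_eq[of q f x g] ray_act_eq[of q' f' x g] ray_act_eq[of "q + q'" "f + f'" x g]
    by (simp add: pderiv_add)
qed

lemma ray_act_scale:
  assumes "f \<in> M" "\<And>t. ray x t \<in> Y"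
  shows "ray_act x (scale_fun c f) = scale_fun c (ray_act x f)"
proof
  fix g
  obtain q where "\<And>t. poly q t = f (ray x t ** g)"
    using section_ray_poly assms by metis
  thus "ray_act x (scale_fun c f) g = scale_fun c (ray_act x f) g"
    using ray_act_eq[of q f x g] ray_act_eq[of "smult c q" "scale_fun c f" x g]
    by (simp add: pderiv_smult scale_fun_def)
qed

lemma double_0: "(z :: 'k) + z = 0"
  using two by (metis mult_2 mult_zero_left)

text \<open>
  Acting twice gives twice the quadratic coefficient, which is zero in characteristic 2.
\<close>

lemma ray_act_square:
  assumes "f \<in> M" "\<And>t. ray x t \<in> Y" "x ** x = 0"
  shows "ray_act x (ray_act x f) = 0"
proof
  fix g
  obtain q where q: "\<And>t. poly q t = f (ray x t ** g)"
    using section_ray_poly assms by metis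
  have "poly (pderiv q) t = ray_act x f (ray x t ** g)" for t
    using ray_act_ray[OF assms(3) q] by simp
  from ray_act_eq[OF this] show "ray_act x (ray_act x f) g = 0 g"
    by (simp add: poly_0_coeff_0 coeff_pderiv numeral_2_eq_2 double_0 algebra_simps)
qed

lemma ray_inverse:
  assumes "x ** x = 0" "det (ray x t) = 1"
  shows "matrix_inv (ray x t) = ray x (t :: 'k)"
  using ray_add[OF assms(1), of t t] adj3_unique[OF assms(2)] matrix_inv_adj3[OF assms(2)]
  by (simp add: double_0)

text \<open>
  In characteristic 2 the elements \<open>1 + t x\<close> are involutions, so no inverse appears on the right. The right-hand
  side does not mention \<open>H\<close>, so \<open>B\<close> and \<open>SL(3)\<close> give the same operator.
\<close>

lemma lie_act_eq_ray_act:
  assumes H: "subgroup H SL3" "H \<subseteq> Y" and x: "x ** x = 0" "\<And>t. ray x t \<in> H" and f: "f \<in> M"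
  shows "lie_act H x f = ray_act x f"
proof
  fix g
  let ?\<phi> = "\<lambda>h. left_translate h f g"
  have inv: "matrix_inv h = adj3 h" "adj3 h \<in> Y" if "h \<in> H" for h
    using that H(2) matrix_inv_adj3 det_Y adj3_Y by auto
  have "\<exists>F\<in>polyfun. \<forall>h\<in>H. F h = ?\<phi> h"
  proof (cases "g \<in> Y")
    case True
    obtain F where F: "F \<in> polyfun" "\<And>g. g \<in> Y \<Longrightarrow> f g = F g"
      using section_polyfun[OF f] by blast
    have "\<forall>h\<in>H. F (adj3 h ** g) = ?\<phi> h"
      using inv F(2) mult_Y True by (simp add: left_translate_def)
    thus ?thesis by (rule bexI[OF _ polyfun_translate[OF F(1)]])
  next
    case False
    hence "\<forall>h\<in>H. 0 = ?\<phi> h"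
      using inv section_0[OF f] mult_Y_iff by (simp add: left_translate_def)
    thus ?thesis by (rule bexI[OF _ polyfun.const])
  qed
  then obtain F where "F \<in> polyfun" "\<And>h. h \<in> H \<Longrightarrow> F h = ?\<phi> h" by blast
  from tangent_deriv_ray[OF x(2) this]
  have "lie_act H x f g = lin_coeff (\<lambda>t. ?\<phi> (ray x t))" by (simp add: lie_act_def)
  also have "\<dots> = ray_act x f g"
    using ray_inverse[OF x(1)] x(2) H(2) det_Y
    by (simp add: ray_act_def left_translate_def subset_iff)
  finally show "lie_act H x f g = ray_act x f g" .
qed

lemma null_lower_ray_Y: "x \<in> null_lower \<Longrightarrow> ray x t \<in> Y"
  using null_lower_ray Y(2) by blast

lemma support_variety_null_lower:
  assumes H: "subgroup H SL3" "Borel \<subseteq> H" "H \<subseteq> Y"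
  shows "support_variety H M \<inter> null_lower =
    {x \<in> null_lower. \<not> kx_projective M (ray_act x)} \<union> {0}"
proof -
  have "x \<in> restricted_nullcone (Lie H) \<and> (kx_projective M (lie_act H x) \<longleftrightarrow> kx_projective M (ray_act x))"
    if x: "x \<in> null_lower" for x
  proof
    have ray: "ray x t \<in> H" for t using null_lower_ray[OF x] H(2) by blast
    show "x \<in> restricted_nullcone (Lie H)"
      using Lie_ray[OF ray] null_lower_square[OF x] by (simp add: restricted_nullcone_def)
    show "kx_projective M (lie_act H x) \<longleftrightarrow> kx_projective M (ray_act x)"
      using lie_act_eq_ray_act[OF H(1,3) null_lower_square[OF x] ray] by (rule kx_projective_cong)
  qed
  moreover have "0 \<in> null_lower" by (simp add: null_lower_def)
  ultimately show ?thesis unfolding support_variety_def by auto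
qed

lemma support_variety_Borel:
  "support_variety Borel M = {x \<in> null_lower. \<not> kx_projective M (ray_act x)} \<union> {0}"
proof -
  have "support_variety Borel M \<subseteq> null_lower"
    unfolding support_variety_def restricted_nullcone_Borel by (auto simp: null_lower_def)
  thus ?thesis using support_variety_null_lower[OF subgroup_Borel subset_refl Y(2)] by blast
qed

text \<open>
  Over all of \<open>SL(3)\<close> this is the highest weight vector, the one weight vector that does not vanish at
  the base point of the flag variety.
\<close>

definition highest_section :: "'k mat3 \<Rightarrow> 'k" where
  "highest_section g = (if g \<in> Y
     then (g$2$2 * g$3$3 - g$2$3 * g$3$2) ^ nat (fst lam) * g$3$3 ^ nat (snd lam) else 0)"

lemma highest_section: "highest_section \<in> M"
proof (rule sectionI)
  let ?F = "\<lambda>g. (g$2$2 * g$3$3 - g$2$3 * g$3$2) ^ nat (fst lam) * g$3$3 ^ nat (snd lam)"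
  show "?F \<in> polyfun" by (intro polyfun_intros)
  fix g b :: "'k mat3" assume "b \<in> Borel"
  hence "(g ** b)$2$2 * (g ** b)$3$3 - (g ** b)$2$3 * (g ** b)$3$2 =
           b$2$2 * b$3$3 * (g$2$2 * g$3$3 - g$2$3 * g$3$2)" "(g ** b)$3$3 = b$3$3 * g$3$3"
    by (simp_all add: Borel_iff mult_nth algebra_simps)
  thus "?F (g ** b) = (b$2$2 * b$3$3) ^ nat (fst lam) * b$3$3 ^ nat (snd lam) * ?F g"
    by (simp add: power_mult_distrib)
qed (simp_all add: highest_section_def)

text \<open>
  The highest weight section is not in the image of \<open>x\<close>: it is nonzero at the identity matrix, and \<open>x f\<close> vanishes there because
  \<open>f\<close> is constant on the unipotent elements of \<open>B\<close>.
\<close>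

lemma not_projective:
  assumes x: "x \<in> null_lower" and act: "ray_act x highest_section = (\<lambda>_. 0)"
  shows "\<not> kx_projective M (ray_act x)"
proof
  assume "kx_projective M (ray_act x)"
  then obtain f where f: "f \<in> M" "ray_act x f = highest_section"
    using kx_projective_kernel_image highest_section act by metis
  have "poly [:f (mat 1):] t = f (ray x t ** mat 1)" for t
    using section_Borel[OF f(1) one_Y null_lower_ray[OF x, of t]] x
    by (simp add: ray_nth null_lower_def)
  from ray_act_eq[OF this] have "ray_act x f (mat 1) = 0" by simp
  thus False using f(2) by (simp add: highest_section_def one_Y mat_1_nth)
qed

lemma even_of_nat_0: "even n \<Longrightarrow> of_nat n = (0 :: 'k)"
  using two by auto

text \<open>
  The action of \<open>x\<close> on the highest weight section produces the exponents \<open>fst lam\<close> and \<open>snd lam\<close> as factors, so an even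
  exponent contributes nothing.
\<close>

lemma not_projective_linear:
  assumes x: "x \<in> null_lower"
    and lin: "\<And>t g. g \<in> Y \<Longrightarrow> (ray x t ** g)$2$2 * (ray x t ** g)$3$3 - (ray x t ** g)$2$3 * (ray x t ** g)$3$2
        = g$2$2 * g$3$3 - g$2$3 * g$3$2 + t * u g"
    and "even (nat (fst lam)) \<or> (\<forall>g\<in>Y. u g = 0)"
    and "even (nat (snd lam)) \<or> (\<forall>g\<in>Y. (x ** g)$3$3 = 0)"
  shows "\<not> kx_projective M (ray_act x)"
proof (rule not_projective[OF x], rule ext)
  fix g
  let ?p = "[:g$2$2 * g$3$3 - g$2$3 * g$3$2, u g:]" and ?q = "[:g$3$3, (x ** g)$3$3:]"
  show "ray_act x highest_section g = 0"
  proof (cases "g \<in> Y")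
    case True
    have "poly (?p ^ nat (fst lam) * ?q ^ nat (snd lam)) t = highest_section (ray x t ** g)" for t
      using mult_Y[OF null_lower_ray_Y[OF x] True]
      by (simp only: highest_section_def lin[OF True] if_True) (simp add: ray_mult_nth)
    from ray_act_eq[OF this] show ?thesis
      using assms(3,4) True
      by (auto simp: pderiv_mult pderiv_power pderiv_pCons even_of_nat_0)
  next
    case False
    have "poly 0 t = highest_section (ray x t ** g)" for t
      using mult_Y_iff[OF null_lower_ray_Y[OF x]] False by (simp add: highest_section_def)
    from ray_act_eq[OF this] show ?thesis by simp
  qed
qed

text \<open>
  The homotopy is \<open>c\<^sup>-\<^sup>1 e\<close>. The hypothesis \<open>chart\<close> says that \<open>x\<close> moves the points \<open>ray e r\<close> by fractional linear
  transformations up to a factor in \<open>B\<close>, with the automorphy factor of degree \<open>n\<close>. In the coordinate \<open>r\<close>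
  a section becomes a polynomial \<open>q\<close>, on which \<open>e\<close> acts by \<open>q \<mapsto> q'\<close> and \<open>x\<close> by \<open>q \<mapsto> c (n r q - r\<^sup>2 q')\<close>. The sum of the
  two compositions is \<open>c n q\<close> modulo 2, and \<open>n\<close> is odd.
\<close>

lemma projective_sl2:
  assumes x: "x ** x = 0" "\<And>t. ray x t \<in> Y" and e: "e ** e = 0" "\<And>t. ray e t \<in> Y"
    and "c \<noteq> 0" "odd n"
    and chart: "\<And>r t. 1 + t * c * r \<noteq> 0 \<Longrightarrow> \<exists>b\<in>Borel.
      ray x t ** ray e r = ray e (r / (1 + t * c * r)) ** b \<and>
      (b$2$2 * b$3$3) ^ nat (fst lam) * b$3$3 ^ nat (snd lam) = (1 + t * c * r) ^ n"
    and determined: "\<And>f. f \<in> M \<Longrightarrow> (\<And>r. f (ray e r) = 0) \<Longrightarrow> f = 0"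
  shows "kx_projective M (ray_act x)"
proof (rule kx_projective_homotopy[where s = "\<lambda>f. scale_fun (inverse c) (ray_act e f)"])
  have n: "of_nat n = (1 :: 'k)"
    using \<open>odd n\<close> by (auto elim!: oddE simp: two)
  note scale_M = fun_space.subspace_scale[OF subspace_M]
  note add_M = fun_space.subspace_add[OF subspace_M]
  have chart_e: "ray_act e f (ray e r) = poly (pderiv q) r" if "\<And>r. poly q r = f (ray e r)" for f q r
    using ray_act_ray[OF e(1), of q f "mat 1" r] that by simp
  have chart_x: "ray_act x f (ray e r) = c * (r * poly q r - r ^ 2 * poly (pderiv q) r)"
    if f: "f \<in> M" and q: "\<And>r. poly q r = f (ray e r)" for f q r
  proof -
    obtain Q where Q: "\<And>t. poly Q t = f (ray x t ** ray e r)"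
      using section_ray_poly[OF f x(2)] by blast
    have "poly Q t = (1 + t * c * r) ^ n * poly q (r / (1 + t * c * r))" if "1 + t * c * r \<noteq> 0" for t
      using chart[OF that] section_Borel[OF f e(2)] by (auto simp: Q q)
    from chart_derivative[OF this] ray_act_eq[OF Q] show ?thesis by (simp add: n)
  qed
  show "scale_fun (inverse c) (ray_act e (ray_act x f)) + ray_act x (scale_fun (inverse c) (ray_act e f)) = f"
    if f: "f \<in> M" for f
  proof -
    \<comment> \<open>The defect of the homotopy identity is itself a section, so it may be tested on the chart.\<close>
    define f' where "f' = ray_act e (ray_act x f) + ray_act x (ray_act e f) + scale_fun (- c) f"
    obtain q where q: "\<And>r. poly q r = f (ray e r)"
      using section_ray_poly[OF f e(2), of "mat 1"] by auto
    define p where "p = [:0, c:] * q - [:0, 0, c:] * pderiv q"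
    have p: "poly p r = ray_act x f (ray e r)" for r
      by (simp add: p_def chart_x[OF f q] power2_eq_square algebra_simps)
    have "ray_act x (ray_act e f) (ray e r) = c * (r * poly (pderiv q) r - r ^ 2 * poly (pderiv (pderiv q)) r)" for r
      using chart_x[OF ray_act_section[OF f e(2)], of "pderiv q"] chart_e[OF q] by simp
    moreover have "ray_act e (ray_act x f) (ray e r) =
        c * (poly q r + r * poly (pderiv q) r) - c * (2 * r * poly (pderiv q) r + r ^ 2 * poly (pderiv (pderiv q)) r)" for r
      unfolding chart_e[OF p]
      by (simp add: p_def pderiv_mult pderiv_diff pderiv_pCons pderiv_smult power2_eq_square algebra_simps)
    ultimately have "f' (ray e r) = 2 * (- c * r ^ 2 * poly (pderiv (pderiv q)) r)" for r
      by (simp add: f'_def scale_fun_def flip: q) (simp add: algebra_simps)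
    hence "f' (ray e r) = 0" for r by (simp add: two)
    moreover have "f' \<in> M"
      unfolding f'_def using f x(2) e(2) by (intro add_M scale_M ray_act_section)
    ultimately have "f' = 0" using determined by blast
    hence "f' g = 0" for g by simp
    hence "ray_act e (ray_act x f) g + ray_act x (ray_act e f) g = c * f g" for g
      unfolding f'_def by (simp add: scale_fun_def)
    moreover have "ray_act x (scale_fun (inverse c) (ray_act e f)) = scale_fun (inverse c) (ray_act x (ray_act e f))"
      using ray_act_scale[OF ray_act_section[OF f e(2)] x(2)] .
    ultimately show ?thesis
      using \<open>c \<noteq> 0\<close> by (simp add: fun_eq_iff scale_fun_def flip: distrib_left)
  qed
next
  note act_M = ray_act_section[OF _ x(2)] and act_e_M = ray_act_section[OF _ e(2)]
  show "fun_space.subspace M" by (rule subspace_M)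
  show "ray_act x f \<in> M" if "f \<in> M" for f using act_M[OF that] .
  show "ray_act x (f + g) = ray_act x f + ray_act x g" if "f \<in> M" "g \<in> M" for f g
    using ray_act_add[OF that x(2)] .
  show "ray_act x (scale_fun d f) = scale_fun d (ray_act x f)" if "f \<in> M" for d f
    using ray_act_scale[OF that x(2)] .
  show "ray_act x (ray_act x f) = 0" if "f \<in> M" for f
    using ray_act_square[OF that x(2) x(1)] .
  show "scale_fun (inverse c) (ray_act e f) \<in> M" if "f \<in> M" for f
    using act_e_M[OF that] by (rule fun_space.subspace_scale[OF subspace_M])
  show "scale_fun (inverse c) (ray_act e (f + g)) =
      scale_fun (inverse c) (ray_act e f) + scale_fun (inverse c) (ray_act e g)"
    if "f \<in> M" "g \<in> M" for f g
    by (simp only: ray_act_add[OF that e(2)] fun_space.scale_right_distrib)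
  show "scale_fun (inverse c) (ray_act e (scale_fun d f)) =
      scale_fun d (scale_fun (inverse c) (ray_act e f))" if "f \<in> M" for d f
    by (simp only: ray_act_scale[OF that e(2)] fun_space.scale_scale mult.commute)
qed

end

section \<open>Sections over the minimal parabolics\<close>

lemma unit_ray_cancel:
  assumes "i \<noteq> j"
  shows "ray (unit_mat i j) t ** (ray (unit_mat i j) (- t) ** g) = g"
  using ray_add[OF unit_mat_square[OF assms], of t "- t"] by (simp add: matrix_mul_assoc)

lemma P_alpha_chart:
  assumes x: "x \<in> null_lower" and nz: "1 + t * x$2$1 * r \<noteq> (0::'k::field)"
  shows "\<exists>b\<in>Borel. ray x t ** ray (unit_mat 1 2) r =
      ray (unit_mat 1 2) (r / (1 + t * x$2$1 * r)) ** b \<and>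
      b$2$2 = 1 + t * x$2$1 * r \<and> b$3$3 = 1"
proof (intro bexI conjI)
  let ?b = "ray (unit_mat 1 2) (- (r / (1 + t * x$2$1 * r))) ** (ray x t ** ray (unit_mat 1 2) r)"
  show "ray x t ** ray (unit_mat 1 2) r = ray (unit_mat 1 2) (r / (1 + t * x$2$1 * r)) ** ?b"
    by (rule unit_ray_cancel[symmetric]) simp
  show "?b $ 2 $ 2 = 1 + t * x$2$1 * r" "?b $ 3 $ 3 = 1"
    using x by (simp_all add: mult_nth ray_nth null_lower_def)
  have "det (ray x t) = 1" using null_lower_ray[OF x] by (simp add: Borel_def)
  thus "?b \<in> Borel"
    using x nz unfolding Borel_def
    by (simp add: det_mul det_ray_unit) (simp add: mult_nth ray_nth null_lower_def field_simps)
qed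

lemma P_beta_chart:
  assumes x: "x \<in> null_lower" and nz: "1 + t * x$3$2 * r \<noteq> (0::'k::field)"
  shows "\<exists>b\<in>Borel. ray x t ** ray (unit_mat 2 3) r =
      ray (unit_mat 2 3) (r / (1 + t * x$3$2 * r)) ** b \<and>
      b$2$2 * b$3$3 = 1 \<and> b$3$3 = 1 + t * x$3$2 * r"
proof (intro bexI conjI)
  let ?b = "ray (unit_mat 2 3) (- (r / (1 + t * x$3$2 * r))) ** (ray x t ** ray (unit_mat 2 3) r)"
  show "ray x t ** ray (unit_mat 2 3) r = ray (unit_mat 2 3) (r / (1 + t * x$3$2 * r)) ** ?b"
    by (rule unit_ray_cancel[symmetric]) simp
  show "?b $ 3 $ 3 = 1 + t * x$3$2 * r" "?b $ 2 $ 2 * ?b $ 3 $ 3 = 1"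
    using x nz by (simp_all add: mult_nth ray_nth null_lower_def field_simps)
  have "det (ray x t) = 1" using null_lower_ray[OF x] by (simp add: Borel_def)
  thus "?b \<in> Borel"
    using x nz unfolding Borel_def
    by (simp add: det_mul det_ray_unit) (simp add: mult_nth ray_nth null_lower_def field_simps)
qed

context schubert_sections
begin

text \<open>
  The translates of the points \<open>ray (unit_mat i j) r\<close> by \<open>B\<close> fill the open subset of \<open>Y\<close> where the entry at \<open>(j, j)\<close> is
  nonzero, and every other point of \<open>Y\<close> is a limit along a line through this subset.
\<close>

lemma section_zeroI:
  assumes f: "f \<in> M" and e: "i \<noteq> j" "\<And>t. ray (unit_mat i j) t \<in> Y" "\<And>t. ray (unit_mat j i) t \<in> Y"
    and zero: "\<And>r. f (ray (unit_mat i j) r) = 0"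
    and cell: "\<And>g. g \<in> Y \<Longrightarrow> g$j$j \<noteq> 0 \<Longrightarrow> ray (unit_mat i j) (- (g$i$j / g$j$j)) ** g \<in> Borel"
    and cell': "\<And>g. g \<in> Y \<Longrightarrow> g$j$j = 0 \<Longrightarrow> g$i$j \<noteq> 0"
  shows "f = 0"
proof
  have generic: "f g = 0" if g: "g \<in> Y" "g$j$j \<noteq> 0" for g
  proof -
    let ?r = "g$i$j / g$j$j" and ?b = "ray (unit_mat i j) (- (g$i$j / g$j$j)) ** g"
    have "f (ray (unit_mat i j) ?r ** ?b) = 0"
      using section_Borel[OF f e(2) cell[OF g]] by (simp only: zero mult_zero_right)
    thus ?thesis by (simp only: unit_ray_cancel[OF e(1)])
  qed
  obtain F where F: "F \<in> polyfun" "\<And>g. g \<in> Y \<Longrightarrow> f g = F g"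
    using section_polyfun[OF f] by blast
  fix g show "f g = 0 g"
  proof (cases "g \<in> Y \<and> g$j$j = 0")
    case True
    have "F g = 0"
    proof (rule polyfun_zero_limit[OF F(1)])
      fix t :: 'k assume "t \<noteq> 0"
      let ?g = "ray (unit_mat j i) t ** g"
      have "(unit_mat j i ** g)$j$j = g$i$j"
        using exhaust_3[of i] by (auto simp: mult_nth)
      hence "?g$j$j = t * g$i$j" using True by (simp add: ray_mult_nth)
      hence "?g$j$j \<noteq> 0" using \<open>t \<noteq> 0\<close> cell' True by simp
      moreover have "?g \<in> Y" using mult_Y e(3) True by blast
      ultimately show "F ?g = 0" using generic F(2) by metis
    qed
    thus ?thesis using F(2) True by simp
  next
    case False
    thus ?thesis using generic section_0[OF f] by auto
  qed
qed

lemma not_projective_Borel: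
  assumes "Y = Borel" "x \<in> null_lower"
  shows "\<not> kx_projective M (ray_act x)"
  by (rule not_projective_linear[OF assms(2), where u = "\<lambda>_. 0"])
     (use assms in \<open>auto simp: null_lower_def Borel_iff mult_nth ray_nth\<close>)

lemma projective_P_alpha_iff:
  assumes Y_alpha: "Y = P_alpha" and x: "x \<in> null_lower"
  shows "kx_projective M (ray_act x) \<longleftrightarrow> x$2$1 \<noteq> 0 \<and> odd (nat (fst lam))"
proof (cases "x$2$1 \<noteq> 0 \<and> odd (nat (fst lam))")
  case True
  have rays: "ray (unit_mat 1 2) t \<in> Y" "ray (unit_mat 2 1) t \<in> Y" for t
    using det_ray_unit[of 1 2 t] det_ray_unit[of 2 1 t] by (simp_all add: Y_alpha P_alpha_def ray_nth)
  have "kx_projective M (ray_act x)"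
  proof (rule projective_sl2[where e = "unit_mat 1 2" and c = "x$2$1" and n = "nat (fst lam)"])
    fix r t assume "1 + t * x$2$1 * r \<noteq> 0"
    from P_alpha_chart[OF x this]
    show "\<exists>b\<in>Borel. ray x t ** ray (unit_mat 1 2) r = ray (unit_mat 1 2) (r / (1 + t * x$2$1 * r)) ** b \<and>
      (b$2$2 * b$3$3) ^ nat (fst lam) * b$3$3 ^ nat (snd lam) = (1 + t * x$2$1 * r) ^ nat (fst lam)"
      by force
  next
    fix f assume f: "f \<in> M" and zero: "\<And>r. f (ray (unit_mat 1 2) r) = 0"
    show "f = 0"
    proof (rule section_zeroI[OF f _ rays(1) rays(2) zero])
      fix g assume g: "g \<in> Y"
      show "ray (unit_mat 1 2) (- (g$1$2 / g$2$2)) ** g \<in> Borel" if "g$2$2 \<noteq> 0"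
        using g that unfolding Borel_def Y_alpha P_alpha_def
        by (simp add: det_mul det_ray_unit) (simp add: mult_nth ray_nth)
      show "g$1$2 \<noteq> 0" if "g$2$2 = 0"
        using g that by (auto simp: Y_alpha P_alpha_def det_3)
    qed simp
  qed (use True x rays null_lower_square null_lower_ray_Y in \<open>simp_all add: unit_mat_square\<close>)
  thus ?thesis using True by simp
next
  case False
  have "\<not> kx_projective M (ray_act x)"
    by (rule not_projective_linear[OF x, where u = "\<lambda>g. x$2$1 * g$1$2 * g$3$3"])
       (use False x in \<open>auto simp: Y_alpha P_alpha_def null_lower_def mult_nth ray_nth algebra_simps\<close>)
  thus ?thesis using False by simp
qed

lemma projective_P_beta_iff:
  assumes Y_beta: "Y = P_beta" and x: "x \<in> null_lower"
  shows "kx_projective M (ray_act x) \<longleftrightarrow> x$3$2 \<noteq> 0 \<and> odd (nat (snd lam))"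
proof (cases "x$3$2 \<noteq> 0 \<and> odd (nat (snd lam))")
  case True
  have rays: "ray (unit_mat 2 3) t \<in> Y" "ray (unit_mat 3 2) t \<in> Y" for t
    using det_ray_unit[of 2 3 t] det_ray_unit[of 3 2 t] by (simp_all add: Y_beta P_beta_def ray_nth)
  have "kx_projective M (ray_act x)"
  proof (rule projective_sl2[where e = "unit_mat 2 3" and c = "x$3$2" and n = "nat (snd lam)"])
    fix r t assume "1 + t * x$3$2 * r \<noteq> 0"
    from P_beta_chart[OF x this]
    show "\<exists>b\<in>Borel. ray x t ** ray (unit_mat 2 3) r = ray (unit_mat 2 3) (r / (1 + t * x$3$2 * r)) ** b \<and>
      (b$2$2 * b$3$3) ^ nat (fst lam) * b$3$3 ^ nat (snd lam) = (1 + t * x$3$2 * r) ^ nat (snd lam)"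
      by force
  next
    fix f assume f: "f \<in> M" and zero: "\<And>r. f (ray (unit_mat 2 3) r) = 0"
    show "f = 0"
    proof (rule section_zeroI[OF f _ rays(1) rays(2) zero])
      fix g assume g: "g \<in> Y"
      show "ray (unit_mat 2 3) (- (g$2$3 / g$3$3)) ** g \<in> Borel" if "g$3$3 \<noteq> 0"
        using g that unfolding Borel_def Y_beta P_beta_def
        by (simp add: det_mul det_ray_unit) (simp add: mult_nth ray_nth)
      show "g$2$3 \<noteq> 0" if "g$3$3 = 0"
        using g that by (auto simp: Y_beta P_beta_def det_3)
    qed simp
  qed (use True x rays null_lower_square null_lower_ray_Y in \<open>simp_all add: unit_mat_square\<close>)
  thus ?thesis using True by simp
next
  case False
  have "\<not> kx_projective M (ray_act x)"
    by (rule not_projective_linear[OF x, where u = "\<lambda>_. 0"])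
       (use False x in \<open>auto simp: Y_beta P_beta_def null_lower_def mult_nth ray_nth algebra_simps\<close>)
  thus ?thesis using False by simp
qed

end

section \<open>The support varieties\<close>

theorem mainTheorem13:
  fixes lam :: weight
  assumes "CHAR('k::alg_closed_field) = 2"
    and "dominant lam"
  shows "V_B1 (H0w (mat 1) lam :: ('k mat3 \<Rightarrow> 'k) set) = u_alpha \<union> u_beta
    \<and> V_B1 (H0w s_alpha lam :: ('k mat3 \<Rightarrow> 'k) set) =
          (if 2 dvd fst lam + 1 then u_alpha else u_alpha \<union> u_beta)
    \<and> V_B1 (H0w s_beta lam :: ('k mat3 \<Rightarrow> 'k) set) =
          (if 2 dvd snd lam + 1 then u_beta else u_alpha \<union> u_beta)
    \<and> V_B1 (H0w (s_alpha ** s_beta ** s_alpha) lam :: ('k mat3 \<Rightarrow> 'k) set) =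
          V_G1 (H0 lam) \<inter> (u_alpha \<union> u_beta)"
proof -
  have two: "(2::'k) = 0"
    using of_nat_CHAR[where ?'a = 'k] assms(1) by simp
  note un = u_alpha_Un_u_beta[OF two] and alpha = u_alpha_eq[OF two] and beta = u_beta_eq[OF two]
  have zero: "(0 :: 'k mat3) \<in> null_lower" by (simp add: null_lower_def)
  have parity: "odd (nat (fst lam)) \<longleftrightarrow> 2 dvd fst lam + 1" "odd (nat (snd lam)) \<longleftrightarrow> 2 dvd snd lam + 1"
    using assms(2) by (auto simp: dominant_def even_nat_iff)
  interpret B: schubert_sections "Borel :: 'k mat3 set" lam
    by (rule schubert_sections.intro[OF two assms(2) subgroup_Borel subset_refl])
  interpret A: schubert_sections "P_alpha :: 'k mat3 set" lam
    by (rule schubert_sections.intro[OF two assms(2) subgroup_P_alpha Borel_subset_P(1)])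
  interpret P: schubert_sections "P_beta :: 'k mat3 set" lam
    by (rule schubert_sections.intro[OF two assms(2) subgroup_P_beta Borel_subset_P(2)])
  interpret G: schubert_sections "carrier SL3 :: 'k mat3 set" lam
    by (rule schubert_sections.intro[OF two assms(2) subgroup_carrier_SL3 Borel_subset_SL3])
  have "V_B1 (H0w (mat 1) lam :: ('k mat3 \<Rightarrow> 'k) set) = null_lower"
    unfolding H0w_def schubert_preimage_e B.support_variety_Borel
    using B.not_projective_Borel zero by auto
  moreover have "V_B1 (H0w s_alpha lam :: ('k mat3 \<Rightarrow> 'k) set) =
      (if 2 dvd fst lam + 1 then u_alpha else null_lower)"
    unfolding H0w_def schubert_preimage_s_alpha A.support_variety_Borel alpha
    using A.projective_P_alpha_iff parity zero by auto
  moreover have "V_B1 (H0w s_beta lam :: ('k mat3 \<Rightarrow> 'k) set) =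
      (if 2 dvd snd lam + 1 then u_beta else null_lower)"
    unfolding H0w_def schubert_preimage_s_beta P.support_variety_Borel beta
    using P.projective_P_beta_iff parity zero by auto
  moreover have "V_B1 (H0w (s_alpha ** s_beta ** s_alpha) lam :: ('k mat3 \<Rightarrow> 'k) set) =
      V_G1 (H0 lam) \<inter> null_lower"
    unfolding H0w_def H0_def schubert_preimage_longest G.support_variety_Borel
      G.support_variety_null_lower[OF subgroup_carrier_SL3 G.Y(2) subset_refl] ..
  ultimately show ?thesis unfolding un by blast
qed

end
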